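(* Let $(\mathrm{H},\mathrm{D.A})$ be any of the pairs $(\mathrm{H.TQBA},\mathrm{D.TQBA})$, $(\mathrm{H.TQBA5},\mathrm{D.TQBA5})$, $(\mathrm{H.IA1},\mathrm{D.IA1})$, $(\mathrm{H.IA2},\mathrm{D.IA2})$, $(\mathrm{H.IA3},\mathrm{D.IA3})$, $(\mathrm{H.PRA},\mathrm{D.PRA})$. For every $\mathrm{H}$-derivable sequent $A\vdash B$ (with $A,B$ formulas of $\mathcal{L}$), the sequent $A^\tau\vdash B^\tau$ is derivable in $\mathrm{D.A}$.
   Context: **The logics H.** Formulas of $\mathcal{L}$: $A::=p\mid\top\mid\bot\mid\neg A\mid IA\mid CA\mid A\land A\mid A\lor A$, with $p$ from a denumerable set of propositional variables. Sequents are $A\vdash B$ with $A,B$ formulas. De Morgan logic has axioms $A\vdash A$, $\bot\vdash A$, $A\vdash\top$, $A\land B\vdash A$, $A\land B\vdash B$, $A\vdash A\lor B$, $B\vdash A\lor B$, $A\land(B\lor E)\vdash(A\land B)\lor(A\land E)$, $A\vdash\neg\neg A$, $\neg\neg A\vdash A$, and rules: from $A\vdash B$ and $B\vdash E$ infer $A\vdash E$; from $A\vdash B$ and $A\vdash E$ infer $A\vdash B\land E$; from $A\vdash E$ and $B\vdash E$ infer $A\lor B\vdash E$; from $A\vdash B$ infer $\neg B\vdash\neg A$. $\mathrm{H.TQBA}$ adds to De Morgan logic the axioms $IA\vdash A$, $IA\vdash IIA$, $I(A\land B)\vdash IA\land IB$, $IA\land IB\vdash I(A\land B)$, $\top\vdash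 I\top$, $CA\vdash\neg I\neg A$, $\neg I\neg A\vdash CA$, $\neg C\neg A\vdash IA$, $IA\vdash\neg C\neg A$, and the monotonicity rule from $A\vdash B$ infer $IA\vdash IB$. Consider: (1) $CIA\vdash IA$; (2) $\top\vdash IA\lor\neg IA$; (3) $I(A\lor B)\vdash IA\lor IB$; (4) the rule: from $IA\vdash IB$ and $CA\vdash CB$ infer $A\vdash B$. $\mathrm{H.TQBA5}$, $\mathrm{H.IA1}$, $\mathrm{H.IA2}$, $\mathrm{H.IA3}$, $\mathrm{H.PRA}$ are the extensions of $\mathrm{H.TQBA}$ by, respectively, (1); (1),(2); (1),(3); (1),(4); (1),(2),(3),(4). **Language of the display calculi.** Three types $\mathsf{D},\mathsf{K}_I,\mathsf{K}_C$. Formulas: $\mathsf{D}$: $A::=p\mid\top\mid\bot\mid\circ_I\alpha\mid\circ_C\xi\mid\neg A\mid A\land A\mid A\lor A$; $\mathsf{K}_I$: $\alpha::=\blacksquare_I A\mid 1_I\mid 0_I\mid\alpha\cap\alpha\mid\alpha\cup\alpha\mid(\sim\alpha)$; $\mathsf{K}_C$: $\xi::=◆_C A\mid 1_C\mid 0_C\mid\xi\sqcap\xi\mid\xi\sqcup\xi\mid(-\xi)$. Structures (structural connectives carry $\hat{\ },\check{\ },\tilde{\ }$): $X::=A\mid\check\bot\mid\hat\top\mid\tilde\circ_C\Pi\mid\tilde\circ_I\Gamma\mid\tilde\neg X\mid X\,\hat\land\,X\mid X\,\check\lor\,X\mid X\,\hat\succ\,X\mid X\,\check\to\,X$; $\Gamma::=\alpha\mid\check\blacksquare_I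 X\mid\hat{◆}_I X\mid\check 0_I\mid\hat 1_I\mid\Gamma\,\hat\cap\,\Gamma\mid\Gamma\,\check\cup\,\Gamma\mid\Gamma\,\hat\succ_I\,\Gamma\mid\Gamma\,\check\to_I\,\Gamma\mid(\tilde\sim\Gamma)$; $\Pi::=\xi\mid\hat{◆}_C X\mid\check\blacksquare_C X\mid\check 0_C\mid\hat 1_C\mid\Pi\,\hat\sqcap\,\Pi\mid\Pi\,\check\sqcup\,\Pi\mid\Pi\,\hat\succ_C\,\Pi\mid\Pi\,\check\to_C\,\Pi\mid(\tilde-\Pi)$. Here $\hat\succ,\hat\succ_I,\hat\succ_C$ are structural co-implications and $\check\to,\check\to_I,\check\to_C$ structural implications. Items in round brackets belong only to $\mathrm{D.TQBA5}$ and its extensions. Sequents relate two structures of the same type. Variables: $X,Y,Z,W$ of type $\mathsf{D}$; $\Gamma,\Delta,\Lambda$ of type $\mathsf{K}_I$; $\Pi,\Sigma,\Omega$ of type $\mathsf{K}_C$. Below "$S\,/\,S'$" means from $S$ infer $S'$, and "$S\,/\!/\,S'$" means the rule can be applied in both directions. **Rules of $\mathrm{D.TQBA}$.** - Identity $p\vdash p$. Cut in each type: $X\vdash A$ and $A\vdash Y$ / $X\vdash Y$; $\Gamma\vdash\alpha$ and $\alpha\vdash\Delta$ / $\Gamma\vdash\Delta$; $\Pi\vdash\xi$ and $\xi\vdash\Sigma$ / $\Pi\vdash\Sigma$. - Pure display rules: $X\,\hat\land\,Y\vdash Z$ // $Y\vdash X\,\check\to\,Z$; $X\vdash Y\,\check\lor\,Z$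 // $Y\,\hat\succ\,X\vdash Z$; $\tilde\neg X\vdash Y$ // $\tilde\neg Y\vdash X$; $X\vdash\tilde\neg Y$ // $Y\vdash\tilde\neg X$; $\Gamma\,\hat\cap\,\Delta\vdash\Lambda$ // $\Delta\vdash\Gamma\,\check\to_I\,\Lambda$; $\Gamma\vdash\Delta\,\check\cup\,\Lambda$ // $\Delta\,\hat\succ_I\,\Gamma\vdash\Lambda$; $\Pi\,\hat\sqcap\,\Sigma\vdash\Omega$ // $\Sigma\vdash\Pi\,\check\to_C\,\Omega$; $\Pi\vdash\Sigma\,\check\sqcup\,\Omega$ // $\Sigma\,\hat\succ_C\,\Pi\vdash\Omega$. - Multi-type display rules: $\tilde\circ_I\Gamma\vdash Y$ // $\Gamma\vdash\check\blacksquare_I Y$; $Y\vdash\tilde\circ_I\Gamma$ // $\hat{◆}_I Y\vdash\Gamma$; $Y\vdash\tilde\circ_C\Pi$ // $\hat{◆}_C Y\vdash\Pi$; $\tilde\circ_C\Pi\vdash X$ // $\Pi\vdash\check\blacksquare_C X$. - Pure structural rules: in each type, standard weakening, contraction, commutativity and associativity, for the structural conjunction ($\hat\land,\hat\cap,\hat\sqcap$) on the left of $\vdash$ and the structural disjunction ($\check\lor,\check\cup,\check\sqcup$) on the right; $X\vdash Y$ // $\tilde\neg Y\vdash\tilde\neg X$; $X\vdash Y$ // $X\,\hat\land\,\hat\top\vdash Y$; $X\vdash Y$ // $X\vdash Y\,\check\lor\,\check\bot$; and likewise for $(\hat\cap,\hat 1_I)$, $(\check\cup,\check 0_I)$, $(\hat\sqcap,\hat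 1_C)$, $(\check\sqcup,\check 0_C)$. - Multi-type structural rules: $\hat\top\vdash Y$ // $\tilde\circ_I\hat 1_I\vdash Y$; $\Gamma\vdash\check\blacksquare_I\check\bot$ // $\Gamma\vdash\check 0_I$; $\hat{◆}_C\hat\top\vdash\Pi$ // $\hat 1_C\vdash\Pi$; $X\vdash\check\bot$ // $X\vdash\tilde\circ_C\check 0_C$; $\tilde\circ_I\Gamma\vdash\tilde\circ_I\Delta$ // $\Gamma\vdash\Delta$; $\tilde\circ_C\Pi\vdash\tilde\circ_C\Sigma$ // $\Pi\vdash\Sigma$; $\hat{◆}_C X\vdash\check\blacksquare_C Y$ / $X\vdash Y$; $\hat{◆}_I X\vdash\check\blacksquare_I Y$ / $X\vdash Y$; $X\vdash\tilde\circ_I\check\blacksquare_I\tilde\neg Y$ // $X\vdash\tilde\neg\tilde\circ_C\hat{◆}_C Y$; $X\vdash\tilde\circ_C\check\blacksquare_C\tilde\neg Y$ // $X\vdash\tilde\neg\tilde\circ_I\hat{◆}_I Y$; $\tilde\circ_C\hat{◆}_C\tilde\neg X\vdash Y$ // $\tilde\neg\tilde\circ_I\check\blacksquare_I X\vdash Y$; $\tilde\circ_I\hat{◆}_I\tilde\neg X\vdash Y$ // $\tilde\neg\tilde\circ_C\check\blacksquare_C X\vdash Y$. - Operational rules for pure-type connectives (standard): $\hat\top\vdash\top$; $\hat\top\vdash X$ / $\top\vdash X$; $\bot\vdash\check\bot$; $X\vdash\check\bot$ / $X\vdash\bot$; $A\,\hat\land\,B\vdash X$ / $A\land B\vdash X$;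 $X\vdash A$ and $Y\vdash B$ / $X\,\hat\land\,Y\vdash A\land B$; $A\vdash X$ and $B\vdash Y$ / $A\lor B\vdash X\,\check\lor\,Y$; $X\vdash A\,\check\lor\,B$ / $X\vdash A\lor B$; $\tilde\neg A\vdash X$ / $\neg A\vdash X$; $X\vdash\tilde\neg A$ / $X\vdash\neg A$; and likewise for $1_I,0_I,\cap,\cup$ and $1_C,0_C,\sqcap,\sqcup$. - Operational rules for multi-type connectives: $\Gamma\vdash\check\blacksquare_I A$ / $\Gamma\vdash\blacksquare_I A$; $A\vdash X$ / $\blacksquare_I A\vdash\check\blacksquare_I X$; $\hat{◆}_C A\vdash\Pi$ / $◆_C A\vdash\Pi$; $X\vdash A$ / $\hat{◆}_C X\vdash ◆_C A$; $X\vdash\tilde\circ_I\alpha$ / $X\vdash\circ_I\alpha$; $\tilde\circ_I\alpha\vdash X$ / $\circ_I\alpha\vdash X$; $X\vdash\tilde\circ_C\xi$ / $X\vdash\circ_C\xi$; $\tilde\circ_C\xi\vdash X$ / $\circ_C\xi\vdash X$. **$\mathrm{D.TQBA5}$** adds: $\tilde\sim\Gamma\vdash\Delta$ // $\tilde\sim\Delta\vdash\Gamma$; $\Gamma\vdash\tilde\sim\Delta$ // $\Delta\vdash\tilde\sim\Gamma$; $\tilde-\Pi\vdash\Sigma$ // $\tilde-\Sigma\vdash\Pi$; $\Pi\vdash\tilde-\Sigma$ // $\Sigma\vdash\tilde-\Pi$; $\Gamma\vdash\Delta$ // $\tilde\sim\Delta\vdash\tilde\sim\Gamma$; $\Pi\vdash\Sigma$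 // $\tilde-\Sigma\vdash\tilde-\Pi$; $X\vdash\tilde\circ_I\check\blacksquare_I Y$ // $X\vdash\tilde\circ_C\check\blacksquare_C Y$; $X\vdash\tilde\circ_I\tilde\sim\Gamma$ / $X\vdash\tilde\neg\tilde\circ_I\Gamma$; $X\vdash\tilde\circ_C\tilde-\Pi$ / $X\vdash\tilde\neg\tilde\circ_C\Pi$; and operational rules $\Gamma\vdash\tilde\sim\alpha$ / $\Gamma\vdash\sim\alpha$; $\tilde\sim\alpha\vdash\Gamma$ / $\sim\alpha\vdash\Gamma$; $\Pi\vdash\tilde-\xi$ / $\Pi\vdash-\xi$; $\tilde-\xi\vdash\Pi$ / $-\xi\vdash\Pi$. **Extensions of $\mathrm{D.TQBA5}$.** $\mathrm{D.IA1}$ adds (cgri): $\Gamma\,\hat\cap\,\Delta\vdash\Lambda$ / $\Delta\vdash\tilde\sim\Gamma\,\check\cup\,\Lambda$ and $\Pi\,\hat\sqcap\,\Sigma\vdash\Omega$ / $\Sigma\vdash\tilde-\Pi\,\check\sqcup\,\Omega$. $\mathrm{D.IA2}$ adds $\Gamma\vdash\check\blacksquare_I(X\,\check\lor\,Y)$ / $\Gamma\vdash\check\blacksquare_I X\,\check\cup\,\check\blacksquare_I Y$ and $\hat{◆}_C(X\,\hat\land\,Y)\vdash\Pi$ / $\hat{◆}_C X\,\hat\sqcap\,\hat{◆}_C Y\vdash\Pi$. $\mathrm{D.IA3}$ adds (ia3): $X\vdash Y$ and $W\vdash Z$ / $X\,\hat\land\,\tilde\circ_C\hat{◆}_C W\vdash\tilde\circ_I\check\blacksquare_I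 Y\,\check\lor\,Z$. $\mathrm{D.PRA}$ adds all the rules of $\mathrm{D.IA1}$, $\mathrm{D.IA2}$ and $\mathrm{D.IA3}$. **Translation.** $(\cdot)^\tau$ maps $\mathcal{L}$-formulas to $\mathsf{D}$-formulas: $p^\tau=p$, $\top^\tau=\top$, $\bot^\tau=\bot$, $(A\land B)^\tau=A^\tau\land B^\tau$, $(A\lor B)^\tau=A^\tau\lor B^\tau$, $(\neg A)^\tau=\neg A^\tau$, $(IA)^\tau=\circ_I\blacksquare_I A^\tau$, $(CA)^\tau=\circ_C ◆_C A^\tau$. *)

theory Defs
  imports Main
begin

type_synonym atom = nat

text \<open>The index \<open>L\<close> selects the Hilbert-style logic H.L and the display calculus D.L at once.\<close>

datatype system = TQBA | TQBA5 | IA1 | IA2 | IA3 | PRA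

datatype fm =
    Var atom | Top | Bot | Neg fm | I fm | C fm | And fm fm | Or fm fm

inductive hderivable :: "system \<Rightarrow> fm \<Rightarrow> fm \<Rightarrow> bool" for L :: system where
  h_refl: "hderivable L A A"
| h_bot: "hderivable L Bot A"
| h_top: "hderivable L A Top"
| h_and1: "hderivable L (And A B) A"
| h_and2: "hderivable L (And A B) B"
| h_or1: "hderivable L A (Or A B)"
| h_or2: "hderivable L B (Or A B)"
| h_dist: "hderivable L (And A (Or B E)) (Or (And A B) (And A E))"
| h_dni: "hderivable L A (Neg (Neg A))"
| h_dne: "hderivable L (Neg (Neg A)) A"
| h_trans: "hderivable L A B \<Longrightarrow> hderivable L B E \<Longrightarrow> hderivable L A E"
| h_andI: "hderivable L A B \<Longrightarrow> hderivable L A E \<Longrightarrow> hderivable L A (And B E)"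
| h_orE: "hderivable L A E \<Longrightarrow> hderivable L B E \<Longrightarrow> hderivable L (Or A B) E"
| h_contra: "hderivable L A B \<Longrightarrow> hderivable L (Neg B) (Neg A)"
| h_T: "hderivable L (I A) A"
| h_4: "hderivable L (I A) (I (I A))"
| h_I_and1: "hderivable L (I (And A B)) (And (I A) (I B))"
| h_I_and2: "hderivable L (And (I A) (I B)) (I (And A B))"
| h_I_top: "hderivable L Top (I Top)"
| h_C1: "hderivable L (C A) (Neg (I (Neg A)))"
| h_C2: "hderivable L (Neg (I (Neg A))) (C A)"
| h_I1: "hderivable L (Neg (C (Neg A))) (I A)"
| h_I2: "hderivable L (I A) (Neg (C (Neg A)))"
| h_I_mono: "hderivable L A B \<Longrightarrow> hderivable L (I A) (I B)"
| h_5: "L \<noteq> TQBA \<Longrightarrow> hderivable L (C (I A)) (I A)"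
| h_ia1: "L \<in> {IA1, PRA} \<Longrightarrow> hderivable L Top (Or (I A) (Neg (I A)))"
| h_ia2: "L \<in> {IA2, PRA} \<Longrightarrow> hderivable L (I (Or A B)) (Or (I A) (I B))"
| h_ia3: "L \<in> {IA3, PRA} \<Longrightarrow> hderivable L (I A) (I B) \<Longrightarrow> hderivable L (C A) (C B) \<Longrightarrow>
    hderivable L A B"

text \<open>Formulas of the three types \<open>D\<close>, \<open>K\<^sub>I\<close> and \<open>K\<^sub>C\<close>. The two negations of kernel type are
  constructors here for all calculi; \<open>in_lang\<close> below removes them from D.TQBA.\<close>

datatype dfm =
    DVar atom
  | DTop ("\<top>\<^sub>D")
  | DBot ("\<bottom>\<^sub>D")
  | DCircI ifm ("\<circ>\<^sub>I _" [80] 80)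
  | DCircC cfm ("\<circ>\<^sub>C _" [80] 80)
  | DNeg dfm ("\<not>\<^sub>D _" [80] 80)
  | DAnd dfm dfm (infixr "\<and>\<^sub>D" 70)
  | DOr dfm dfm (infixr "\<or>\<^sub>D" 65)
and ifm =
    IBox dfm ("\<box>\<^sub>I _" [80] 80)
  | IOne ("\<one>\<^sub>I")
  | IZero ("\<zero>\<^sub>I")
  | IAnd ifm ifm (infixr "\<inter>\<^sub>I" 70)
  | IOr ifm ifm (infixr "\<union>\<^sub>I" 65)
  | INeg ifm ("\<sim>\<^sub>I _" [80] 80)
and cfm =
    CDia dfm ("\<diamond>\<^sub>C _" [80] 80)
  | COne ("\<one>\<^sub>C")
  | CZero ("\<zero>\<^sub>C")
  | CAnd cfm cfm (infixr "\<sqinter>\<^sub>C" 70)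
  | COr cfm cfm (infixr "\<squnion>\<^sub>C" 65)
  | CNeg cfm ("-\<^sub>C _" [80] 80)

text \<open>Structures. Structural connectives are typeset in bold; the accents (hat, check, tilde) of the
  display calculus literature are dropped, since no two structural connectives differ in the accent
  alone. \<open>\<box>\<close> and \<open>\<diamond>\<close> stand for the filled box and diamond.\<close>

datatype dst =
    FmD dfm
  | SBot ("\<^bold>\<bottom>")
  | STop ("\<^bold>\<top>")
  | SCircC cst ("\<^bold>\<circ>\<^sub>C _" [80] 80)
  | SCircI ist ("\<^bold>\<circ>\<^sub>I _" [80] 80)
  | SNeg dst ("\<^bold>\<not> _" [80] 80)
  | SAnd dst dst (infixr "\<^bold>\<and>" 70)
  | SOr dst dst (infixr "\<^bold>\<or>" 65)
  | SCoimp dst dst (infixr "\<^bold>\<succ>" 60)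
  | SImp dst dst (infixr "\<^bold>\<rightarrow>" 60)
and ist =
    FmI ifm
  | SBoxI dst ("\<^bold>\<box>\<^sub>I _" [80] 80)
  | SDiaI dst ("\<^bold>\<diamond>\<^sub>I _" [80] 80)
  | SZeroI ("\<^bold>\<zero>\<^sub>I")
  | SOneI ("\<^bold>\<one>\<^sub>I")
  | SAndI ist ist (infixr "\<^bold>\<inter>" 70)
  | SOrI ist ist (infixr "\<^bold>\<union>" 65)
  | SCoimpI ist ist (infixr "\<^bold>\<succ>\<^sub>I" 60)
  | SImpI ist ist (infixr "\<^bold>\<rightarrow>\<^sub>I" 60)
  | SNegI ist ("\<^bold>\<sim> _" [80] 80)
and cst =
    FmC cfm
  | SDiaC dst ("\<^bold>\<diamond>\<^sub>C _" [80] 80)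
  | SBoxC dst ("\<^bold>\<box>\<^sub>C _" [80] 80)
  | SZeroC ("\<^bold>\<zero>\<^sub>C")
  | SOneC ("\<^bold>\<one>\<^sub>C")
  | SAndC cst cst (infixr "\<^bold>\<sqinter>" 70)
  | SOrC cst cst (infixr "\<^bold>\<squnion>" 65)
  | SCoimpC cst cst (infixr "\<^bold>\<succ>\<^sub>C" 60)
  | SImpC cst cst (infixr "\<^bold>\<rightarrow>\<^sub>C" 60)
  | SNegC cst ("\<^bold>- _" [80] 80)

datatype seqt =
    SeqD dst dst (infix "\<turnstile>\<^sub>D" 50)
  | SeqI ist ist (infix "\<turnstile>\<^sub>I" 50)
  | SeqC cst cst (infix "\<turnstile>\<^sub>C" 50)

primrec neg_free_dfm :: "dfm \<Rightarrow> bool"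
  and neg_free_ifm :: "ifm \<Rightarrow> bool"
  and neg_free_cfm :: "cfm \<Rightarrow> bool" where
  "neg_free_dfm (DVar p) = True"
| "neg_free_dfm \<top>\<^sub>D = True"
| "neg_free_dfm \<bottom>\<^sub>D = True"
| "neg_free_dfm (\<circ>\<^sub>I \<alpha>) = neg_free_ifm \<alpha>"
| "neg_free_dfm (\<circ>\<^sub>C \<xi>) = neg_free_cfm \<xi>"
| "neg_free_dfm (\<not>\<^sub>D A) = neg_free_dfm A"
| "neg_free_dfm (A \<and>\<^sub>D B) = (neg_free_dfm A \<and> neg_free_dfm B)"
| "neg_free_dfm (A \<or>\<^sub>D B) = (neg_free_dfm A \<and> neg_free_dfm B)"
| "neg_free_ifm (\<box>\<^sub>I A) = neg_free_dfm A"
| "neg_free_ifm \<one>\<^sub>I = True"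
| "neg_free_ifm \<zero>\<^sub>I = True"
| "neg_free_ifm (\<alpha> \<inter>\<^sub>I \<beta>) = (neg_free_ifm \<alpha> \<and> neg_free_ifm \<beta>)"
| "neg_free_ifm (\<alpha> \<union>\<^sub>I \<beta>) = (neg_free_ifm \<alpha> \<and> neg_free_ifm \<beta>)"
| "neg_free_ifm (\<sim>\<^sub>I \<alpha>) = False"
| "neg_free_cfm (\<diamond>\<^sub>C A) = neg_free_dfm A"
| "neg_free_cfm \<one>\<^sub>C = True"
| "neg_free_cfm \<zero>\<^sub>C = True"
| "neg_free_cfm (\<xi> \<sqinter>\<^sub>C \<chi>) = (neg_free_cfm \<xi> \<and> neg_free_cfm \<chi>)"
| "neg_free_cfm (\<xi> \<squnion>\<^sub>C \<chi>) = (neg_free_cfm \<xi> \<and> neg_free_cfm \<chi>)"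
| "neg_free_cfm (-\<^sub>C \<xi>) = False"

primrec neg_free_dst :: "dst \<Rightarrow> bool"
  and neg_free_ist :: "ist \<Rightarrow> bool"
  and neg_free_cst :: "cst \<Rightarrow> bool" where
  "neg_free_dst (FmD A) = neg_free_dfm A"
| "neg_free_dst \<^bold>\<bottom> = True"
| "neg_free_dst \<^bold>\<top> = True"
| "neg_free_dst (\<^bold>\<circ>\<^sub>C \<Pi>) = neg_free_cst \<Pi>"
| "neg_free_dst (\<^bold>\<circ>\<^sub>I \<Gamma>) = neg_free_ist \<Gamma>"
| "neg_free_dst (\<^bold>\<not> X) = neg_free_dst X"
| "neg_free_dst (X \<^bold>\<and> Y) = (neg_free_dst X \<and> neg_free_dst Y)"
| "neg_free_dst (X \<^bold>\<or> Y) = (neg_free_dst X \<and> neg_free_dst Y)"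
| "neg_free_dst (X \<^bold>\<succ> Y) = (neg_free_dst X \<and> neg_free_dst Y)"
| "neg_free_dst (X \<^bold>\<rightarrow> Y) = (neg_free_dst X \<and> neg_free_dst Y)"
| "neg_free_ist (FmI \<alpha>) = neg_free_ifm \<alpha>"
| "neg_free_ist (\<^bold>\<box>\<^sub>I X) = neg_free_dst X"
| "neg_free_ist (\<^bold>\<diamond>\<^sub>I X) = neg_free_dst X"
| "neg_free_ist \<^bold>\<zero>\<^sub>I = True"
| "neg_free_ist \<^bold>\<one>\<^sub>I = True"
| "neg_free_ist (\<Gamma> \<^bold>\<inter> \<Delta>) = (neg_free_ist \<Gamma> \<and> neg_free_ist \<Delta>)"
| "neg_free_ist (\<Gamma> \<^bold>\<union> \<Delta>) = (neg_free_ist \<Gamma> \<and> neg_free_ist \<Delta>)"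
| "neg_free_ist (\<Gamma> \<^bold>\<succ>\<^sub>I \<Delta>) = (neg_free_ist \<Gamma> \<and> neg_free_ist \<Delta>)"
| "neg_free_ist (\<Gamma> \<^bold>\<rightarrow>\<^sub>I \<Delta>) = (neg_free_ist \<Gamma> \<and> neg_free_ist \<Delta>)"
| "neg_free_ist (\<^bold>\<sim> \<Gamma>) = False"
| "neg_free_cst (FmC \<xi>) = neg_free_cfm \<xi>"
| "neg_free_cst (\<^bold>\<diamond>\<^sub>C X) = neg_free_dst X"
| "neg_free_cst (\<^bold>\<box>\<^sub>C X) = neg_free_dst X"
| "neg_free_cst \<^bold>\<zero>\<^sub>C = True"
| "neg_free_cst \<^bold>\<one>\<^sub>C = True"
| "neg_free_cst (\<Pi> \<^bold>\<sqinter> \<Sigma>) = (neg_free_cst \<Pi> \<and> neg_free_cst \<Sigma>)"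
| "neg_free_cst (\<Pi> \<^bold>\<squnion> \<Sigma>) = (neg_free_cst \<Pi> \<and> neg_free_cst \<Sigma>)"
| "neg_free_cst (\<Pi> \<^bold>\<succ>\<^sub>C \<Sigma>) = (neg_free_cst \<Pi> \<and> neg_free_cst \<Sigma>)"
| "neg_free_cst (\<Pi> \<^bold>\<rightarrow>\<^sub>C \<Sigma>) = (neg_free_cst \<Pi> \<and> neg_free_cst \<Sigma>)"
| "neg_free_cst (\<^bold>- \<Pi>) = False"

primrec neg_free :: "seqt \<Rightarrow> bool" where
  "neg_free (X \<turnstile>\<^sub>D Y) = (neg_free_dst X \<and> neg_free_dst Y)"
| "neg_free (\<Gamma> \<turnstile>\<^sub>I \<Delta>) = (neg_free_ist \<Gamma> \<and> neg_free_ist \<Delta>)"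
| "neg_free (\<Pi> \<turnstile>\<^sub>C \<Sigma>) = (neg_free_cst \<Pi> \<and> neg_free_cst \<Sigma>)"

definition in_lang :: "system \<Rightarrow> seqt \<Rightarrow> bool" where
  "in_lang L S \<longleftrightarrow> (L = TQBA \<longrightarrow> neg_free S)"

text \<open>Invertible (double-line) rules; \<open>inf_rule\<close> below closes them under both directions.\<close>

inductive bi_rule :: "system \<Rightarrow> seqt \<Rightarrow> seqt \<Rightarrow> bool" for L :: system where
  res_conj_D: "bi_rule L (X \<^bold>\<and> Y \<turnstile>\<^sub>D Z) (Y \<turnstile>\<^sub>D X \<^bold>\<rightarrow> Z)"
| res_disj_D: "bi_rule L (X \<turnstile>\<^sub>D Y \<^bold>\<or> Z) (Y \<^bold>\<succ> X \<turnstile>\<^sub>D Z)"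
| top_D: "bi_rule L (X \<turnstile>\<^sub>D Y) (X \<^bold>\<and> \<^bold>\<top> \<turnstile>\<^sub>D Y)"
| bot_D: "bi_rule L (X \<turnstile>\<^sub>D Y) (X \<turnstile>\<^sub>D Y \<^bold>\<or> \<^bold>\<bottom>)"
| assoc_L_D: "bi_rule L (X \<^bold>\<and> (Y \<^bold>\<and> Z) \<turnstile>\<^sub>D W) ((X \<^bold>\<and> Y) \<^bold>\<and> Z \<turnstile>\<^sub>D W)"
| assoc_R_D: "bi_rule L (X \<turnstile>\<^sub>D Y \<^bold>\<or> (Z \<^bold>\<or> W)) (X \<turnstile>\<^sub>D (Y \<^bold>\<or> Z) \<^bold>\<or> W)"
| res_conj_I: "bi_rule L (\<Gamma> \<^bold>\<inter> \<Delta> \<turnstile>\<^sub>I \<Lambda>) (\<Delta> \<turnstile>\<^sub>I \<Gamma> \<^bold>\<rightarrow>\<^sub>I \<Lambda>)"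
| res_disj_I: "bi_rule L (\<Gamma> \<turnstile>\<^sub>I \<Delta> \<^bold>\<union> \<Lambda>) (\<Delta> \<^bold>\<succ>\<^sub>I \<Gamma> \<turnstile>\<^sub>I \<Lambda>)"
| top_I: "bi_rule L (\<Gamma> \<turnstile>\<^sub>I \<Delta>) (\<Gamma> \<^bold>\<inter> \<^bold>\<one>\<^sub>I \<turnstile>\<^sub>I \<Delta>)"
| bot_I: "bi_rule L (\<Gamma> \<turnstile>\<^sub>I \<Delta>) (\<Gamma> \<turnstile>\<^sub>I \<Delta> \<^bold>\<union> \<^bold>\<zero>\<^sub>I)"
| assoc_L_I: "bi_rule L (\<Gamma> \<^bold>\<inter> (\<Delta> \<^bold>\<inter> \<Lambda>) \<turnstile>\<^sub>I \<Theta>) ((\<Gamma> \<^bold>\<inter> \<Delta>) \<^bold>\<inter> \<Lambda> \<turnstile>\<^sub>I \<Theta>)"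
| assoc_R_I: "bi_rule L (\<Gamma> \<turnstile>\<^sub>I \<Delta> \<^bold>\<union> (\<Lambda> \<^bold>\<union> \<Theta>)) (\<Gamma> \<turnstile>\<^sub>I (\<Delta> \<^bold>\<union> \<Lambda>) \<^bold>\<union> \<Theta>)"
| res_conj_C: "bi_rule L (\<Pi> \<^bold>\<sqinter> \<Sigma> \<turnstile>\<^sub>C \<Omega>) (\<Sigma> \<turnstile>\<^sub>C \<Pi> \<^bold>\<rightarrow>\<^sub>C \<Omega>)"
| res_disj_C: "bi_rule L (\<Pi> \<turnstile>\<^sub>C \<Sigma> \<^bold>\<squnion> \<Omega>) (\<Sigma> \<^bold>\<succ>\<^sub>C \<Pi> \<turnstile>\<^sub>C \<Omega>)"
| top_C: "bi_rule L (\<Pi> \<turnstile>\<^sub>C \<Sigma>) (\<Pi> \<^bold>\<sqinter> \<^bold>\<one>\<^sub>C \<turnstile>\<^sub>C \<Sigma>)"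
| bot_C: "bi_rule L (\<Pi> \<turnstile>\<^sub>C \<Sigma>) (\<Pi> \<turnstile>\<^sub>C \<Sigma> \<^bold>\<squnion> \<^bold>\<zero>\<^sub>C)"
| assoc_L_C: "bi_rule L (\<Pi> \<^bold>\<sqinter> (\<Sigma> \<^bold>\<sqinter> \<Omega>) \<turnstile>\<^sub>C \<Phi>) ((\<Pi> \<^bold>\<sqinter> \<Sigma>) \<^bold>\<sqinter> \<Omega> \<turnstile>\<^sub>C \<Phi>)"
| assoc_R_C: "bi_rule L (\<Pi> \<turnstile>\<^sub>C \<Sigma> \<^bold>\<squnion> (\<Omega> \<^bold>\<squnion> \<Phi>)) (\<Pi> \<turnstile>\<^sub>C (\<Sigma> \<^bold>\<squnion> \<Omega>) \<^bold>\<squnion> \<Phi>)"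
| neg_adj_L: "bi_rule L (\<^bold>\<not> X \<turnstile>\<^sub>D Y) (\<^bold>\<not> Y \<turnstile>\<^sub>D X)"
| neg_adj_R: "bi_rule L (X \<turnstile>\<^sub>D \<^bold>\<not> Y) (Y \<turnstile>\<^sub>D \<^bold>\<not> X)"
| neg_cont: "bi_rule L (X \<turnstile>\<^sub>D Y) (\<^bold>\<not> Y \<turnstile>\<^sub>D \<^bold>\<not> X)"
| circI_boxI: "bi_rule L (\<^bold>\<circ>\<^sub>I \<Gamma> \<turnstile>\<^sub>D Y) (\<Gamma> \<turnstile>\<^sub>I \<^bold>\<box>\<^sub>I Y)"
| diaI_circI: "bi_rule L (Y \<turnstile>\<^sub>D \<^bold>\<circ>\<^sub>I \<Gamma>) (\<^bold>\<diamond>\<^sub>I Y \<turnstile>\<^sub>I \<Gamma>)"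
| diaC_circC: "bi_rule L (Y \<turnstile>\<^sub>D \<^bold>\<circ>\<^sub>C \<Pi>) (\<^bold>\<diamond>\<^sub>C Y \<turnstile>\<^sub>C \<Pi>)"
| circC_boxC: "bi_rule L (\<^bold>\<circ>\<^sub>C \<Pi> \<turnstile>\<^sub>D X) (\<Pi> \<turnstile>\<^sub>C \<^bold>\<box>\<^sub>C X)"
| circI_one: "bi_rule L (\<^bold>\<top> \<turnstile>\<^sub>D Y) (\<^bold>\<circ>\<^sub>I \<^bold>\<one>\<^sub>I \<turnstile>\<^sub>D Y)"
| boxI_bot: "bi_rule L (\<Gamma> \<turnstile>\<^sub>I \<^bold>\<box>\<^sub>I \<^bold>\<bottom>) (\<Gamma> \<turnstile>\<^sub>I \<^bold>\<zero>\<^sub>I)"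
| diaC_top: "bi_rule L (\<^bold>\<diamond>\<^sub>C \<^bold>\<top> \<turnstile>\<^sub>C \<Pi>) (\<^bold>\<one>\<^sub>C \<turnstile>\<^sub>C \<Pi>)"
| circC_zero: "bi_rule L (X \<turnstile>\<^sub>D \<^bold>\<bottom>) (X \<turnstile>\<^sub>D \<^bold>\<circ>\<^sub>C \<^bold>\<zero>\<^sub>C)"
| circI_mono: "bi_rule L (\<^bold>\<circ>\<^sub>I \<Gamma> \<turnstile>\<^sub>D \<^bold>\<circ>\<^sub>I \<Delta>) (\<Gamma> \<turnstile>\<^sub>I \<Delta>)"
| circC_mono: "bi_rule L (\<^bold>\<circ>\<^sub>C \<Pi> \<turnstile>\<^sub>D \<^bold>\<circ>\<^sub>C \<Sigma>) (\<Pi> \<turnstile>\<^sub>C \<Sigma>)"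
| boxI_neg: "bi_rule L (X \<turnstile>\<^sub>D \<^bold>\<circ>\<^sub>I \<^bold>\<box>\<^sub>I \<^bold>\<not> Y) (X \<turnstile>\<^sub>D \<^bold>\<not> \<^bold>\<circ>\<^sub>C \<^bold>\<diamond>\<^sub>C Y)"
| boxC_neg: "bi_rule L (X \<turnstile>\<^sub>D \<^bold>\<circ>\<^sub>C \<^bold>\<box>\<^sub>C \<^bold>\<not> Y) (X \<turnstile>\<^sub>D \<^bold>\<not> \<^bold>\<circ>\<^sub>I \<^bold>\<diamond>\<^sub>I Y)"
| diaC_neg: "bi_rule L (\<^bold>\<circ>\<^sub>C \<^bold>\<diamond>\<^sub>C \<^bold>\<not> X \<turnstile>\<^sub>D Y) (\<^bold>\<not> \<^bold>\<circ>\<^sub>I \<^bold>\<box>\<^sub>I X \<turnstile>\<^sub>D Y)"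
| diaI_neg: "bi_rule L (\<^bold>\<circ>\<^sub>I \<^bold>\<diamond>\<^sub>I \<^bold>\<not> X \<turnstile>\<^sub>D Y) (\<^bold>\<not> \<^bold>\<circ>\<^sub>C \<^bold>\<box>\<^sub>C X \<turnstile>\<^sub>D Y)"
| negI_adj_L: "L \<noteq> TQBA \<Longrightarrow> bi_rule L (\<^bold>\<sim> \<Gamma> \<turnstile>\<^sub>I \<Delta>) (\<^bold>\<sim> \<Delta> \<turnstile>\<^sub>I \<Gamma>)"
| negI_adj_R: "L \<noteq> TQBA \<Longrightarrow> bi_rule L (\<Gamma> \<turnstile>\<^sub>I \<^bold>\<sim> \<Delta>) (\<Delta> \<turnstile>\<^sub>I \<^bold>\<sim> \<Gamma>)"
| negC_adj_L: "L \<noteq> TQBA \<Longrightarrow> bi_rule L (\<^bold>- \<Pi> \<turnstile>\<^sub>C \<Sigma>) (\<^bold>- \<Sigma> \<turnstile>\<^sub>C \<Pi>)"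
| negC_adj_R: "L \<noteq> TQBA \<Longrightarrow> bi_rule L (\<Pi> \<turnstile>\<^sub>C \<^bold>- \<Sigma>) (\<Sigma> \<turnstile>\<^sub>C \<^bold>- \<Pi>)"
| negI_cont: "L \<noteq> TQBA \<Longrightarrow> bi_rule L (\<Gamma> \<turnstile>\<^sub>I \<Delta>) (\<^bold>\<sim> \<Delta> \<turnstile>\<^sub>I \<^bold>\<sim> \<Gamma>)"
| negC_cont: "L \<noteq> TQBA \<Longrightarrow> bi_rule L (\<Pi> \<turnstile>\<^sub>C \<Sigma>) (\<^bold>- \<Sigma> \<turnstile>\<^sub>C \<^bold>- \<Pi>)"
| boxI_boxC: "L \<noteq> TQBA \<Longrightarrow> bi_rule L (X \<turnstile>\<^sub>D \<^bold>\<circ>\<^sub>I \<^bold>\<box>\<^sub>I Y) (X \<turnstile>\<^sub>D \<^bold>\<circ>\<^sub>C \<^bold>\<box>\<^sub>C Y)"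

inductive inf_rule :: "system \<Rightarrow> seqt list \<Rightarrow> seqt \<Rightarrow> bool" for L :: system where
  bi_down: "bi_rule L S S' \<Longrightarrow> inf_rule L [S] S'"
| bi_up: "bi_rule L S S' \<Longrightarrow> inf_rule L [S'] S"
| ident: "inf_rule L [] (FmD (DVar p) \<turnstile>\<^sub>D FmD (DVar p))"
| cut_D: "inf_rule L [X \<turnstile>\<^sub>D FmD A, FmD A \<turnstile>\<^sub>D Y] (X \<turnstile>\<^sub>D Y)"
| weak_L_D: "inf_rule L [X \<turnstile>\<^sub>D Z] (X \<^bold>\<and> Y \<turnstile>\<^sub>D Z)"
| weak_R_D: "inf_rule L [X \<turnstile>\<^sub>D Y] (X \<turnstile>\<^sub>D Y \<^bold>\<or> Z)"
| contr_L_D: "inf_rule L [X \<^bold>\<and> X \<turnstile>\<^sub>D Y] (X \<turnstile>\<^sub>D Y)"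
| contr_R_D: "inf_rule L [X \<turnstile>\<^sub>D Y \<^bold>\<or> Y] (X \<turnstile>\<^sub>D Y)"
| comm_L_D: "inf_rule L [X \<^bold>\<and> Y \<turnstile>\<^sub>D Z] (Y \<^bold>\<and> X \<turnstile>\<^sub>D Z)"
| comm_R_D: "inf_rule L [X \<turnstile>\<^sub>D Y \<^bold>\<or> Z] (X \<turnstile>\<^sub>D Z \<^bold>\<or> Y)"
| one_R_D: "inf_rule L [] (\<^bold>\<top> \<turnstile>\<^sub>D FmD \<top>\<^sub>D)"
| one_L_D: "inf_rule L [\<^bold>\<top> \<turnstile>\<^sub>D X] (FmD \<top>\<^sub>D \<turnstile>\<^sub>D X)"
| zero_L_D: "inf_rule L [] (FmD \<bottom>\<^sub>D \<turnstile>\<^sub>D \<^bold>\<bottom>)"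
| zero_R_D: "inf_rule L [X \<turnstile>\<^sub>D \<^bold>\<bottom>] (X \<turnstile>\<^sub>D FmD \<bottom>\<^sub>D)"
| conj_L_D: "inf_rule L [FmD A \<^bold>\<and> FmD B \<turnstile>\<^sub>D X] (FmD (A \<and>\<^sub>D B) \<turnstile>\<^sub>D X)"
| conj_R_D: "inf_rule L [X \<turnstile>\<^sub>D FmD A, Y \<turnstile>\<^sub>D FmD B] (X \<^bold>\<and> Y \<turnstile>\<^sub>D FmD (A \<and>\<^sub>D B))"
| disj_L_D: "inf_rule L [FmD A \<turnstile>\<^sub>D X, FmD B \<turnstile>\<^sub>D Y] (FmD (A \<or>\<^sub>D B) \<turnstile>\<^sub>D X \<^bold>\<or> Y)"
| disj_R_D: "inf_rule L [X \<turnstile>\<^sub>D FmD A \<^bold>\<or> FmD B] (X \<turnstile>\<^sub>D FmD (A \<or>\<^sub>D B))"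
| cut_I: "inf_rule L [\<Gamma> \<turnstile>\<^sub>I FmI \<alpha>, FmI \<alpha> \<turnstile>\<^sub>I \<Delta>] (\<Gamma> \<turnstile>\<^sub>I \<Delta>)"
| weak_L_I: "inf_rule L [\<Gamma> \<turnstile>\<^sub>I \<Lambda>] (\<Gamma> \<^bold>\<inter> \<Delta> \<turnstile>\<^sub>I \<Lambda>)"
| weak_R_I: "inf_rule L [\<Gamma> \<turnstile>\<^sub>I \<Delta>] (\<Gamma> \<turnstile>\<^sub>I \<Delta> \<^bold>\<union> \<Lambda>)"
| contr_L_I: "inf_rule L [\<Gamma> \<^bold>\<inter> \<Gamma> \<turnstile>\<^sub>I \<Delta>] (\<Gamma> \<turnstile>\<^sub>I \<Delta>)"
| contr_R_I: "inf_rule L [\<Gamma> \<turnstile>\<^sub>I \<Delta> \<^bold>\<union> \<Delta>] (\<Gamma> \<turnstile>\<^sub>I \<Delta>)"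
| comm_L_I: "inf_rule L [\<Gamma> \<^bold>\<inter> \<Delta> \<turnstile>\<^sub>I \<Lambda>] (\<Delta> \<^bold>\<inter> \<Gamma> \<turnstile>\<^sub>I \<Lambda>)"
| comm_R_I: "inf_rule L [\<Gamma> \<turnstile>\<^sub>I \<Delta> \<^bold>\<union> \<Lambda>] (\<Gamma> \<turnstile>\<^sub>I \<Lambda> \<^bold>\<union> \<Delta>)"
| one_R_I: "inf_rule L [] (\<^bold>\<one>\<^sub>I \<turnstile>\<^sub>I FmI \<one>\<^sub>I)"
| one_L_I: "inf_rule L [\<^bold>\<one>\<^sub>I \<turnstile>\<^sub>I \<Gamma>] (FmI \<one>\<^sub>I \<turnstile>\<^sub>I \<Gamma>)"
| zero_L_I: "inf_rule L [] (FmI \<zero>\<^sub>I \<turnstile>\<^sub>I \<^bold>\<zero>\<^sub>I)"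
| zero_R_I: "inf_rule L [\<Gamma> \<turnstile>\<^sub>I \<^bold>\<zero>\<^sub>I] (\<Gamma> \<turnstile>\<^sub>I FmI \<zero>\<^sub>I)"
| conj_L_I: "inf_rule L [FmI \<alpha> \<^bold>\<inter> FmI \<beta> \<turnstile>\<^sub>I \<Gamma>] (FmI (\<alpha> \<inter>\<^sub>I \<beta>) \<turnstile>\<^sub>I \<Gamma>)"
| conj_R_I: "inf_rule L [\<Gamma> \<turnstile>\<^sub>I FmI \<alpha>, \<Delta> \<turnstile>\<^sub>I FmI \<beta>] (\<Gamma> \<^bold>\<inter> \<Delta> \<turnstile>\<^sub>I FmI (\<alpha> \<inter>\<^sub>I \<beta>))"
| disj_L_I: "inf_rule L [FmI \<alpha> \<turnstile>\<^sub>I \<Gamma>, FmI \<beta> \<turnstile>\<^sub>I \<Delta>] (FmI (\<alpha> \<union>\<^sub>I \<beta>) \<turnstile>\<^sub>I \<Gamma> \<^bold>\<union> \<Delta>)"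
| disj_R_I: "inf_rule L [\<Gamma> \<turnstile>\<^sub>I FmI \<alpha> \<^bold>\<union> FmI \<beta>] (\<Gamma> \<turnstile>\<^sub>I FmI (\<alpha> \<union>\<^sub>I \<beta>))"
| cut_C: "inf_rule L [\<Pi> \<turnstile>\<^sub>C FmC \<xi>, FmC \<xi> \<turnstile>\<^sub>C \<Sigma>] (\<Pi> \<turnstile>\<^sub>C \<Sigma>)"
| weak_L_C: "inf_rule L [\<Pi> \<turnstile>\<^sub>C \<Omega>] (\<Pi> \<^bold>\<sqinter> \<Sigma> \<turnstile>\<^sub>C \<Omega>)"
| weak_R_C: "inf_rule L [\<Pi> \<turnstile>\<^sub>C \<Sigma>] (\<Pi> \<turnstile>\<^sub>C \<Sigma> \<^bold>\<squnion> \<Omega>)"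
| contr_L_C: "inf_rule L [\<Pi> \<^bold>\<sqinter> \<Pi> \<turnstile>\<^sub>C \<Sigma>] (\<Pi> \<turnstile>\<^sub>C \<Sigma>)"
| contr_R_C: "inf_rule L [\<Pi> \<turnstile>\<^sub>C \<Sigma> \<^bold>\<squnion> \<Sigma>] (\<Pi> \<turnstile>\<^sub>C \<Sigma>)"
| comm_L_C: "inf_rule L [\<Pi> \<^bold>\<sqinter> \<Sigma> \<turnstile>\<^sub>C \<Omega>] (\<Sigma> \<^bold>\<sqinter> \<Pi> \<turnstile>\<^sub>C \<Omega>)"
| comm_R_C: "inf_rule L [\<Pi> \<turnstile>\<^sub>C \<Sigma> \<^bold>\<squnion> \<Omega>] (\<Pi> \<turnstile>\<^sub>C \<Omega> \<^bold>\<squnion> \<Sigma>)"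
| one_R_C: "inf_rule L [] (\<^bold>\<one>\<^sub>C \<turnstile>\<^sub>C FmC \<one>\<^sub>C)"
| one_L_C: "inf_rule L [\<^bold>\<one>\<^sub>C \<turnstile>\<^sub>C \<Pi>] (FmC \<one>\<^sub>C \<turnstile>\<^sub>C \<Pi>)"
| zero_L_C: "inf_rule L [] (FmC \<zero>\<^sub>C \<turnstile>\<^sub>C \<^bold>\<zero>\<^sub>C)"
| zero_R_C: "inf_rule L [\<Pi> \<turnstile>\<^sub>C \<^bold>\<zero>\<^sub>C] (\<Pi> \<turnstile>\<^sub>C FmC \<zero>\<^sub>C)"
| conj_L_C: "inf_rule L [FmC \<xi> \<^bold>\<sqinter> FmC \<chi> \<turnstile>\<^sub>C \<Pi>] (FmC (\<xi> \<sqinter>\<^sub>C \<chi>) \<turnstile>\<^sub>C \<Pi>)"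
| conj_R_C: "inf_rule L [\<Pi> \<turnstile>\<^sub>C FmC \<xi>, \<Sigma> \<turnstile>\<^sub>C FmC \<chi>] (\<Pi> \<^bold>\<sqinter> \<Sigma> \<turnstile>\<^sub>C FmC (\<xi> \<sqinter>\<^sub>C \<chi>))"
| disj_L_C: "inf_rule L [FmC \<xi> \<turnstile>\<^sub>C \<Pi>, FmC \<chi> \<turnstile>\<^sub>C \<Sigma>] (FmC (\<xi> \<squnion>\<^sub>C \<chi>) \<turnstile>\<^sub>C \<Pi> \<^bold>\<squnion> \<Sigma>)"
| disj_R_C: "inf_rule L [\<Pi> \<turnstile>\<^sub>C FmC \<xi> \<^bold>\<squnion> FmC \<chi>] (\<Pi> \<turnstile>\<^sub>C FmC (\<xi> \<squnion>\<^sub>C \<chi>))"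
| diaC_boxC: "inf_rule L [\<^bold>\<diamond>\<^sub>C X \<turnstile>\<^sub>C \<^bold>\<box>\<^sub>C Y] (X \<turnstile>\<^sub>D Y)"
| diaI_boxI: "inf_rule L [\<^bold>\<diamond>\<^sub>I X \<turnstile>\<^sub>I \<^bold>\<box>\<^sub>I Y] (X \<turnstile>\<^sub>D Y)"
| neg_L: "inf_rule L [\<^bold>\<not> FmD A \<turnstile>\<^sub>D X] (FmD (\<not>\<^sub>D A) \<turnstile>\<^sub>D X)"
| neg_R: "inf_rule L [X \<turnstile>\<^sub>D \<^bold>\<not> FmD A] (X \<turnstile>\<^sub>D FmD (\<not>\<^sub>D A))"
| boxI_R: "inf_rule L [\<Gamma> \<turnstile>\<^sub>I \<^bold>\<box>\<^sub>I FmD A] (\<Gamma> \<turnstile>\<^sub>I FmI (\<box>\<^sub>I A))"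
| boxI_L: "inf_rule L [FmD A \<turnstile>\<^sub>D X] (FmI (\<box>\<^sub>I A) \<turnstile>\<^sub>I \<^bold>\<box>\<^sub>I X)"
| diaC_L: "inf_rule L [\<^bold>\<diamond>\<^sub>C FmD A \<turnstile>\<^sub>C \<Pi>] (FmC (\<diamond>\<^sub>C A) \<turnstile>\<^sub>C \<Pi>)"
| diaC_R: "inf_rule L [X \<turnstile>\<^sub>D FmD A] (\<^bold>\<diamond>\<^sub>C X \<turnstile>\<^sub>C FmC (\<diamond>\<^sub>C A))"
| circI_R: "inf_rule L [X \<turnstile>\<^sub>D \<^bold>\<circ>\<^sub>I FmI \<alpha>] (X \<turnstile>\<^sub>D FmD (\<circ>\<^sub>I \<alpha>))"
| circI_L: "inf_rule L [\<^bold>\<circ>\<^sub>I FmI \<alpha> \<turnstile>\<^sub>D X] (FmD (\<circ>\<^sub>I \<alpha>) \<turnstile>\<^sub>D X)"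
| circC_R: "inf_rule L [X \<turnstile>\<^sub>D \<^bold>\<circ>\<^sub>C FmC \<xi>] (X \<turnstile>\<^sub>D FmD (\<circ>\<^sub>C \<xi>))"
| circC_L: "inf_rule L [\<^bold>\<circ>\<^sub>C FmC \<xi> \<turnstile>\<^sub>D X] (FmD (\<circ>\<^sub>C \<xi>) \<turnstile>\<^sub>D X)"
| circI_negI: "L \<noteq> TQBA \<Longrightarrow> inf_rule L [X \<turnstile>\<^sub>D \<^bold>\<circ>\<^sub>I \<^bold>\<sim> \<Gamma>] (X \<turnstile>\<^sub>D \<^bold>\<not> \<^bold>\<circ>\<^sub>I \<Gamma>)"
| circC_negC: "L \<noteq> TQBA \<Longrightarrow> inf_rule L [X \<turnstile>\<^sub>D \<^bold>\<circ>\<^sub>C \<^bold>- \<Pi>] (X \<turnstile>\<^sub>D \<^bold>\<not> \<^bold>\<circ>\<^sub>C \<Pi>)"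
| negI_R: "L \<noteq> TQBA \<Longrightarrow> inf_rule L [\<Gamma> \<turnstile>\<^sub>I \<^bold>\<sim> FmI \<alpha>] (\<Gamma> \<turnstile>\<^sub>I FmI (\<sim>\<^sub>I \<alpha>))"
| negI_L: "L \<noteq> TQBA \<Longrightarrow> inf_rule L [\<^bold>\<sim> FmI \<alpha> \<turnstile>\<^sub>I \<Gamma>] (FmI (\<sim>\<^sub>I \<alpha>) \<turnstile>\<^sub>I \<Gamma>)"
| negC_R: "L \<noteq> TQBA \<Longrightarrow> inf_rule L [\<Pi> \<turnstile>\<^sub>C \<^bold>- FmC \<xi>] (\<Pi> \<turnstile>\<^sub>C FmC (-\<^sub>C \<xi>))"
| negC_L: "L \<noteq> TQBA \<Longrightarrow> inf_rule L [\<^bold>- FmC \<xi> \<turnstile>\<^sub>C \<Pi>] (FmC (-\<^sub>C \<xi>) \<turnstile>\<^sub>C \<Pi>)"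
| cgri_I: "L \<in> {IA1, PRA} \<Longrightarrow> inf_rule L [\<Gamma> \<^bold>\<inter> \<Delta> \<turnstile>\<^sub>I \<Lambda>] (\<Delta> \<turnstile>\<^sub>I \<^bold>\<sim> \<Gamma> \<^bold>\<union> \<Lambda>)"
| cgri_C: "L \<in> {IA1, PRA} \<Longrightarrow> inf_rule L [\<Pi> \<^bold>\<sqinter> \<Sigma> \<turnstile>\<^sub>C \<Omega>] (\<Sigma> \<turnstile>\<^sub>C \<^bold>- \<Pi> \<^bold>\<squnion> \<Omega>)"
| ia2_I: "L \<in> {IA2, PRA} \<Longrightarrow> inf_rule L [\<Gamma> \<turnstile>\<^sub>I \<^bold>\<box>\<^sub>I (X \<^bold>\<or> Y)] (\<Gamma> \<turnstile>\<^sub>I \<^bold>\<box>\<^sub>I X \<^bold>\<union> \<^bold>\<box>\<^sub>I Y)"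
| ia2_C: "L \<in> {IA2, PRA} \<Longrightarrow> inf_rule L [\<^bold>\<diamond>\<^sub>C (X \<^bold>\<and> Y) \<turnstile>\<^sub>C \<Pi>] (\<^bold>\<diamond>\<^sub>C X \<^bold>\<sqinter> \<^bold>\<diamond>\<^sub>C Y \<turnstile>\<^sub>C \<Pi>)"
| ia3: "L \<in> {IA3, PRA} \<Longrightarrow> inf_rule L [X \<turnstile>\<^sub>D Y, W \<turnstile>\<^sub>D Z] (X \<^bold>\<and> \<^bold>\<circ>\<^sub>C \<^bold>\<diamond>\<^sub>C W \<turnstile>\<^sub>D \<^bold>\<circ>\<^sub>I \<^bold>\<box>\<^sub>I Y \<^bold>\<or> Z)"

text \<open>Every sequent of a derivation has to be a sequent of the language of D.L, so that neither
  weakening nor cut can bring a kernel negation into a D.TQBA derivation.\<close>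

inductive dderivable :: "system \<Rightarrow> seqt \<Rightarrow> bool" for L :: system where
  infer: "inf_rule L Ps S \<Longrightarrow> (\<And>P. P \<in> set Ps \<Longrightarrow> dderivable L P) \<Longrightarrow> in_lang L S \<Longrightarrow>
    dderivable L S"

primrec transl :: "fm \<Rightarrow> dfm" ("_\<^sup>\<tau>" [1000] 999) where
  "(Var p)\<^sup>\<tau> = DVar p"
| "Top\<^sup>\<tau> = \<top>\<^sub>D"
| "Bot\<^sup>\<tau> = \<bottom>\<^sub>D"
| "(Neg A)\<^sup>\<tau> = \<not>\<^sub>D A\<^sup>\<tau>"
| "(I A)\<^sup>\<tau> = \<circ>\<^sub>I \<box>\<^sub>I A\<^sup>\<tau>"
| "(C A)\<^sup>\<tau> = \<circ>\<^sub>C \<diamond>\<^sub>C A\<^sup>\<tau>"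
| "(And A B)\<^sup>\<tau> = A\<^sup>\<tau> \<and>\<^sub>D B\<^sup>\<tau>"
| "(Or A B)\<^sup>\<tau> = A\<^sup>\<tau> \<or>\<^sub>D B\<^sup>\<tau>"

end

theory Submission
  imports Defs
begin

text \<open>
  The proof is an induction on the \<open>H\<close>-derivation: transitivity of \<open>\<turnstile>\<close> is simulated by cut, and each
  other axiom or rule by a derivation in the calculus. The De Morgan part is routine. What makes the
  modal part work is that \<open>I\<close> and \<open>C\<close> are split by the translation into adjoint pairs.

  The modality \<open>I\<close> becomes \<open>\<circ>\<^sub>I \<box>\<^sub>I\<close>, where \<open>\<circ>\<^sub>I\<close> embeds the kernel into the algebra and \<open>\<box>\<^sub>I\<close> is its right
  adjoint. Hence \<open>\<circ>\<^sub>I \<box>\<^sub>I A\<close> is the largest element below \<open>A\<close> in the image of the embedding: it lies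
  below \<open>A\<close> (\<open>interior_below\<close>), and every embedded element below \<open>A\<close> lies below it
  (\<open>interior_greatest\<close>). These two facts give reflexivity, transitivity and
  monotonicity of \<open>I\<close>. That \<open>I\<close> preserves the top and binary meets needs in addition that the
  embedding does; for meets this holds because \<open>\<circ>\<^sub>I\<close> also has a left adjoint (\<open>embed_meet_greatest\<close>). Dually, \<open>C\<close>
  becomes \<open>\<circ>\<^sub>C \<diamond>\<^sub>C\<close> with \<open>\<diamond>\<^sub>C\<close> left adjoint to the embedding \<open>\<circ>\<^sub>C\<close>. The structural rules that move a
  negation through these pairs yield the interdefinability of \<open>I\<close> and \<open>C\<close>.

  Each additional principle is obtained from the rule added for it: \<open>C (I A) \<turnstile> I A\<close> because the calculus makes
  every interior an element of the image of \<open>\<circ>\<^sub>C\<close>, hence closed; excluded middle and distribution over joins for \<open>I A\<close> are the corresponding facts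
  about the kernel, carried over to the algebra by \<open>embed_join_least\<close>; and the last rule follows from
  \<open>A \<and> C B \<turnstile> I A \<or> B\<close>, since its hypotheses make \<open>C B\<close> redundant on the left and \<open>I A\<close> on the right.

  Derivations have to stay in the language of the calculus. All rules but weakening transfer this
  condition from the premises to the conclusion, so it is discharged in the rule lemmas and remains a
  hypothesis only where something is weakened in. The lemmas on modalities hold for arbitrary formulas
  \<open>A\<close> with \<open>A \<turnstile> A\<close> derivable; \<open>transl_refl\<close> supplies this for translations.
\<close>

section \<open>Rules without language conditions\<close>

lemma derivable_in_lang: "dderivable L S \<Longrightarrow> in_lang L S"
  by (auto elim: dderivable.cases)

lemma bi_rule_in_lang: "bi_rule L S S' \<Longrightarrow> in_lang L S \<longleftrightarrow> in_lang L S'"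
  by (induction rule: bi_rule.induct) (auto simp: in_lang_def)

text \<open>As both sides of an invertible rule are in the language or neither is, such a rule can be used in
  either direction without a side condition.\<close>

lemma bi_rule_derivable:
  assumes "bi_rule L S S'"
  shows "dderivable L S \<longleftrightarrow> dderivable L S'"
  using bi_rule_in_lang[OF assms] derivable_in_lang
    dderivable.infer[OF inf_rule.bi_down[OF assms]] dderivable.infer[OF inf_rule.bi_up[OF assms]]
  by auto

lemmas derivable_res_conj_D = bi_rule_derivable[OF bi_rule.res_conj_D]
lemmas derivable_res_disj_D = bi_rule_derivable[OF bi_rule.res_disj_D]
lemmas derivable_res_disj_I = bi_rule_derivable[OF bi_rule.res_disj_I]
lemmas derivable_top_D = bi_rule_derivable[OF bi_rule.top_D]
lemmas derivable_bot_D = bi_rule_derivable[OF bi_rule.bot_D]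
lemmas derivable_neg_adj_L = bi_rule_derivable[OF bi_rule.neg_adj_L]
lemmas derivable_neg_adj_R = bi_rule_derivable[OF bi_rule.neg_adj_R]
lemmas derivable_neg_cont = bi_rule_derivable[OF bi_rule.neg_cont]
lemmas derivable_circI_boxI = bi_rule_derivable[OF bi_rule.circI_boxI]
lemmas derivable_diaI_circI = bi_rule_derivable[OF bi_rule.diaI_circI]
lemmas derivable_diaC_circC = bi_rule_derivable[OF bi_rule.diaC_circC]
lemmas derivable_circC_boxC = bi_rule_derivable[OF bi_rule.circC_boxC]
lemmas derivable_circI_one = bi_rule_derivable[OF bi_rule.circI_one]
lemmas derivable_circI_mono = bi_rule_derivable[OF bi_rule.circI_mono]
lemmas derivable_circC_mono = bi_rule_derivable[OF bi_rule.circC_mono]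
lemmas derivable_boxI_neg = bi_rule_derivable[OF bi_rule.boxI_neg]
lemmas derivable_diaC_neg = bi_rule_derivable[OF bi_rule.diaC_neg]
lemmas derivable_negI_cont = bi_rule_derivable[OF bi_rule.negI_cont]
lemmas derivable_boxI_boxC = bi_rule_derivable[OF bi_rule.boxI_boxC]

text \<open>The condition on the conclusion may be proved from that on the premises, which are in the language
  because they are derivable.\<close>

lemma derivable_unary:
  "inf_rule L [P] S \<Longrightarrow> (in_lang L P \<Longrightarrow> in_lang L S) \<Longrightarrow> dderivable L P \<Longrightarrow> dderivable L S"
  by (rule dderivable.infer) (auto dest: derivable_in_lang)

lemma derivable_binary:
  "inf_rule L [P, Q] S \<Longrightarrow> (in_lang L P \<Longrightarrow> in_lang L Q \<Longrightarrow> in_lang L S) \<Longrightarrow>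
    dderivable L P \<Longrightarrow> dderivable L Q \<Longrightarrow> dderivable L S"
  by (rule dderivable.infer) (auto dest: derivable_in_lang)

lemma derivable_ident: "dderivable L (FmD (DVar p) \<turnstile>\<^sub>D FmD (DVar p))"
  and derivable_one_R_D: "dderivable L (\<^bold>\<top> \<turnstile>\<^sub>D FmD \<top>\<^sub>D)"
  and derivable_zero_L_D: "dderivable L (FmD \<bottom>\<^sub>D \<turnstile>\<^sub>D \<^bold>\<bottom>)"
  by (rule dderivable.infer, rule inf_rule.intros, simp, simp add: in_lang_def)+

lemma derivable_cut_D:
    "dderivable L (X \<turnstile>\<^sub>D FmD A) \<Longrightarrow> dderivable L (FmD A \<turnstile>\<^sub>D Y) \<Longrightarrow> dderivable L (X \<turnstile>\<^sub>D Y)"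
  and derivable_cut_I:
    "dderivable L (\<Gamma> \<turnstile>\<^sub>I FmI \<alpha>) \<Longrightarrow> dderivable L (FmI \<alpha> \<turnstile>\<^sub>I \<Delta>) \<Longrightarrow> dderivable L (\<Gamma> \<turnstile>\<^sub>I \<Delta>)"
  and derivable_conj_R_D:
    "dderivable L (X \<turnstile>\<^sub>D FmD A) \<Longrightarrow> dderivable L (Y \<turnstile>\<^sub>D FmD B) \<Longrightarrow>
      dderivable L (X \<^bold>\<and> Y \<turnstile>\<^sub>D FmD (A \<and>\<^sub>D B))"
  and derivable_disj_L_D:
    "dderivable L (FmD A \<turnstile>\<^sub>D X) \<Longrightarrow> dderivable L (FmD B \<turnstile>\<^sub>D Y) \<Longrightarrow>
      dderivable L (FmD (A \<or>\<^sub>D B) \<turnstile>\<^sub>D X \<^bold>\<or> Y)"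
  and derivable_conj_R_I:
    "dderivable L (\<Gamma> \<turnstile>\<^sub>I FmI \<alpha>) \<Longrightarrow> dderivable L (\<Delta> \<turnstile>\<^sub>I FmI \<beta>) \<Longrightarrow>
      dderivable L (\<Gamma> \<^bold>\<inter> \<Delta> \<turnstile>\<^sub>I FmI (\<alpha> \<inter>\<^sub>I \<beta>))"
  and derivable_disj_L_I:
    "dderivable L (FmI \<alpha> \<turnstile>\<^sub>I \<Gamma>) \<Longrightarrow> dderivable L (FmI \<beta> \<turnstile>\<^sub>I \<Delta>) \<Longrightarrow>
      dderivable L (FmI (\<alpha> \<union>\<^sub>I \<beta>) \<turnstile>\<^sub>I \<Gamma> \<^bold>\<union> \<Delta>)"
  by (erule (1) derivable_binary[rotated 2], rule inf_rule.intros, simp add: in_lang_def)+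

lemma derivable_ia3:
  assumes "L \<in> {IA3, PRA}" "dderivable L (X \<turnstile>\<^sub>D Y)" "dderivable L (W \<turnstile>\<^sub>D Z)"
  shows "dderivable L (X \<^bold>\<and> \<^bold>\<circ>\<^sub>C \<^bold>\<diamond>\<^sub>C W \<turnstile>\<^sub>D \<^bold>\<circ>\<^sub>I \<^bold>\<box>\<^sub>I Y \<^bold>\<or> Z)"
  using derivable_binary[OF inf_rule.ia3[OF assms(1)] _ assms(2,3)] by (simp add: in_lang_def)

lemma derivable_contr_L_D:
    "dderivable L (X \<^bold>\<and> X \<turnstile>\<^sub>D Y) \<Longrightarrow> dderivable L (X \<turnstile>\<^sub>D Y)"
  and derivable_contr_R_D:
    "dderivable L (X \<turnstile>\<^sub>D Y \<^bold>\<or> Y) \<Longrightarrow> dderivable L (X \<turnstile>\<^sub>D Y)"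
  and derivable_comm_L_D:
    "dderivable L (X \<^bold>\<and> Y \<turnstile>\<^sub>D Z) \<Longrightarrow> dderivable L (Y \<^bold>\<and> X \<turnstile>\<^sub>D Z)"
  and derivable_comm_R_D:
    "dderivable L (X \<turnstile>\<^sub>D Y \<^bold>\<or> Z) \<Longrightarrow> dderivable L (X \<turnstile>\<^sub>D Z \<^bold>\<or> Y)"
  and derivable_one_L_D:
    "dderivable L (\<^bold>\<top> \<turnstile>\<^sub>D X) \<Longrightarrow> dderivable L (FmD \<top>\<^sub>D \<turnstile>\<^sub>D X)"
  and derivable_zero_R_D:
    "dderivable L (X \<turnstile>\<^sub>D \<^bold>\<bottom>) \<Longrightarrow> dderivable L (X \<turnstile>\<^sub>D FmD \<bottom>\<^sub>D)"
  and derivable_conj_L_D: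
    "dderivable L (FmD A \<^bold>\<and> FmD B \<turnstile>\<^sub>D X) \<Longrightarrow> dderivable L (FmD (A \<and>\<^sub>D B) \<turnstile>\<^sub>D X)"
  and derivable_disj_R_D:
    "dderivable L (X \<turnstile>\<^sub>D FmD A \<^bold>\<or> FmD B) \<Longrightarrow> dderivable L (X \<turnstile>\<^sub>D FmD (A \<or>\<^sub>D B))"
  and derivable_neg_L:
    "dderivable L (\<^bold>\<not> FmD A \<turnstile>\<^sub>D X) \<Longrightarrow> dderivable L (FmD (\<not>\<^sub>D A) \<turnstile>\<^sub>D X)"
  and derivable_neg_R:
    "dderivable L (X \<turnstile>\<^sub>D \<^bold>\<not> FmD A) \<Longrightarrow> dderivable L (X \<turnstile>\<^sub>D FmD (\<not>\<^sub>D A))"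
  and derivable_contr_L_I:
    "dderivable L (\<Gamma> \<^bold>\<inter> \<Gamma> \<turnstile>\<^sub>I \<Delta>) \<Longrightarrow> dderivable L (\<Gamma> \<turnstile>\<^sub>I \<Delta>)"
  and derivable_contr_R_I:
    "dderivable L (\<Gamma> \<turnstile>\<^sub>I \<Delta> \<^bold>\<union> \<Delta>) \<Longrightarrow> dderivable L (\<Gamma> \<turnstile>\<^sub>I \<Delta>)"
  and derivable_comm_L_I:
    "dderivable L (\<Gamma> \<^bold>\<inter> \<Delta> \<turnstile>\<^sub>I \<Lambda>) \<Longrightarrow> dderivable L (\<Delta> \<^bold>\<inter> \<Gamma> \<turnstile>\<^sub>I \<Lambda>)"
  and derivable_comm_R_I:
    "dderivable L (\<Gamma> \<turnstile>\<^sub>I \<Delta> \<^bold>\<union> \<Lambda>) \<Longrightarrow> dderivable L (\<Gamma> \<turnstile>\<^sub>I \<Lambda> \<^bold>\<union> \<Delta>)"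
  and derivable_conj_L_I:
    "dderivable L (FmI \<alpha> \<^bold>\<inter> FmI \<beta> \<turnstile>\<^sub>I \<Gamma>) \<Longrightarrow> dderivable L (FmI (\<alpha> \<inter>\<^sub>I \<beta>) \<turnstile>\<^sub>I \<Gamma>)"
  and derivable_disj_R_I:
    "dderivable L (\<Gamma> \<turnstile>\<^sub>I FmI \<alpha> \<^bold>\<union> FmI \<beta>) \<Longrightarrow> dderivable L (\<Gamma> \<turnstile>\<^sub>I FmI (\<alpha> \<union>\<^sub>I \<beta>))"
  and derivable_boxI_R:
    "dderivable L (\<Gamma> \<turnstile>\<^sub>I \<^bold>\<box>\<^sub>I FmD A) \<Longrightarrow> dderivable L (\<Gamma> \<turnstile>\<^sub>I FmI (\<box>\<^sub>I A))"
  and derivable_boxI_L: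
    "dderivable L (FmD A \<turnstile>\<^sub>D X) \<Longrightarrow> dderivable L (FmI (\<box>\<^sub>I A) \<turnstile>\<^sub>I \<^bold>\<box>\<^sub>I X)"
  and derivable_diaC_L:
    "dderivable L (\<^bold>\<diamond>\<^sub>C FmD A \<turnstile>\<^sub>C \<Pi>) \<Longrightarrow> dderivable L (FmC (\<diamond>\<^sub>C A) \<turnstile>\<^sub>C \<Pi>)"
  and derivable_diaC_R:
    "dderivable L (X \<turnstile>\<^sub>D FmD A) \<Longrightarrow> dderivable L (\<^bold>\<diamond>\<^sub>C X \<turnstile>\<^sub>C FmC (\<diamond>\<^sub>C A))"
  and derivable_circI_R:
    "dderivable L (X \<turnstile>\<^sub>D \<^bold>\<circ>\<^sub>I FmI \<alpha>) \<Longrightarrow> dderivable L (X \<turnstile>\<^sub>D FmD (\<circ>\<^sub>I \<alpha>))"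
  and derivable_circI_L:
    "dderivable L (\<^bold>\<circ>\<^sub>I FmI \<alpha> \<turnstile>\<^sub>D X) \<Longrightarrow> dderivable L (FmD (\<circ>\<^sub>I \<alpha>) \<turnstile>\<^sub>D X)"
  and derivable_circC_R:
    "dderivable L (X \<turnstile>\<^sub>D \<^bold>\<circ>\<^sub>C FmC \<xi>) \<Longrightarrow> dderivable L (X \<turnstile>\<^sub>D FmD (\<circ>\<^sub>C \<xi>))"
  and derivable_circC_L:
    "dderivable L (\<^bold>\<circ>\<^sub>C FmC \<xi> \<turnstile>\<^sub>D X) \<Longrightarrow> dderivable L (FmD (\<circ>\<^sub>C \<xi>) \<turnstile>\<^sub>D X)"
  by (erule derivable_unary[rotated 2], rule inf_rule.intros, (simp add: in_lang_def)+)+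

lemma derivable_circI_negI:
    "L \<noteq> TQBA \<Longrightarrow> dderivable L (X \<turnstile>\<^sub>D \<^bold>\<circ>\<^sub>I \<^bold>\<sim> \<Gamma>) \<Longrightarrow> dderivable L (X \<turnstile>\<^sub>D \<^bold>\<not> \<^bold>\<circ>\<^sub>I \<Gamma>)"
  and derivable_negI_R:
    "L \<noteq> TQBA \<Longrightarrow> dderivable L (\<Gamma> \<turnstile>\<^sub>I \<^bold>\<sim> FmI \<alpha>) \<Longrightarrow> dderivable L (\<Gamma> \<turnstile>\<^sub>I FmI (\<sim>\<^sub>I \<alpha>))"
  and derivable_negI_L:
    "L \<noteq> TQBA \<Longrightarrow> dderivable L (\<^bold>\<sim> FmI \<alpha> \<turnstile>\<^sub>I \<Gamma>) \<Longrightarrow> dderivable L (FmI (\<sim>\<^sub>I \<alpha>) \<turnstile>\<^sub>I \<Gamma>)"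
  by (erule derivable_unary[rotated 2], rule inf_rule.intros, (auto simp: in_lang_def)+)+

lemma derivable_cgri_I:
    "L \<in> {IA1, PRA} \<Longrightarrow> dderivable L (\<Gamma> \<^bold>\<inter> \<Delta> \<turnstile>\<^sub>I \<Lambda>) \<Longrightarrow> dderivable L (\<Delta> \<turnstile>\<^sub>I \<^bold>\<sim> \<Gamma> \<^bold>\<union> \<Lambda>)"
  by (erule derivable_unary[rotated 2], rule inf_rule.intros, (auto simp: in_lang_def)+)+

lemma derivable_ia2_I:
    "L \<in> {IA2, PRA} \<Longrightarrow> dderivable L (\<Gamma> \<turnstile>\<^sub>I \<^bold>\<box>\<^sub>I (X \<^bold>\<or> Y)) \<Longrightarrow> dderivable L (\<Gamma> \<turnstile>\<^sub>I \<^bold>\<box>\<^sub>I X \<^bold>\<union> \<^bold>\<box>\<^sub>I Y)"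
  by (erule derivable_unary[rotated 2], rule inf_rule.intros, (auto simp: in_lang_def)+)+

lemma derivable_weak_L_D:
    "dderivable L (X \<turnstile>\<^sub>D Z) \<Longrightarrow> (L = TQBA \<Longrightarrow> neg_free_dst Y) \<Longrightarrow>
      dderivable L (X \<^bold>\<and> Y \<turnstile>\<^sub>D Z)"
  and derivable_weak_R_D:
    "dderivable L (X \<turnstile>\<^sub>D Y) \<Longrightarrow> (L = TQBA \<Longrightarrow> neg_free_dst Z) \<Longrightarrow>
      dderivable L (X \<turnstile>\<^sub>D Y \<^bold>\<or> Z)"
  and derivable_weak_L_I:
    "dderivable L (\<Gamma> \<turnstile>\<^sub>I \<Lambda>) \<Longrightarrow> (L = TQBA \<Longrightarrow> neg_free_ist \<Delta>) \<Longrightarrow>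
      dderivable L (\<Gamma> \<^bold>\<inter> \<Delta> \<turnstile>\<^sub>I \<Lambda>)"
  by (erule derivable_unary[rotated 2], rule inf_rule.intros, (auto simp: in_lang_def)+)+

section \<open>Lattice connectives and negation\<close>

lemma bot_least:
  assumes "in_lang L (FmD \<bottom>\<^sub>D \<turnstile>\<^sub>D X)"
  shows "dderivable L (FmD \<bottom>\<^sub>D \<turnstile>\<^sub>D X)"
  using assms
  by (intro derivable_bot_D[THEN iffD2, OF derivable_comm_R_D[OF derivable_weak_R_D[OF derivable_zero_L_D]]])
    (simp add: in_lang_def)

lemma top_greatest:
  assumes "in_lang L (X \<turnstile>\<^sub>D FmD \<top>\<^sub>D)"
  shows "dderivable L (X \<turnstile>\<^sub>D FmD \<top>\<^sub>D)"
  using assms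
  by (intro derivable_top_D[THEN iffD2, OF derivable_comm_L_D[OF derivable_weak_L_D[OF derivable_one_R_D]]])
    (simp add: in_lang_def)

lemma conj_lower1:
  assumes "dderivable L (FmD A \<turnstile>\<^sub>D X)" "L = TQBA \<Longrightarrow> neg_free_dfm B"
  shows "dderivable L (FmD (A \<and>\<^sub>D B) \<turnstile>\<^sub>D X)"
  using assms by (intro derivable_conj_L_D derivable_weak_L_D) auto

lemma conj_lower2:
  assumes "dderivable L (FmD B \<turnstile>\<^sub>D X)" "L = TQBA \<Longrightarrow> neg_free_dfm A"
  shows "dderivable L (FmD (A \<and>\<^sub>D B) \<turnstile>\<^sub>D X)"
  using assms
  by (intro derivable_conj_L_D derivable_comm_L_D[of L "FmD B"] derivable_weak_L_D) auto

lemma disj_upper1: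
  assumes "dderivable L (X \<turnstile>\<^sub>D FmD A)" "L = TQBA \<Longrightarrow> neg_free_dfm B"
  shows "dderivable L (X \<turnstile>\<^sub>D FmD (A \<or>\<^sub>D B))"
  using assms by (intro derivable_disj_R_D derivable_weak_R_D) auto

lemma disj_upper2:
  assumes "dderivable L (X \<turnstile>\<^sub>D FmD B)" "L = TQBA \<Longrightarrow> neg_free_dfm A"
  shows "dderivable L (X \<turnstile>\<^sub>D FmD (A \<or>\<^sub>D B))"
  using assms
  by (intro derivable_disj_R_D derivable_comm_R_D[of L X "FmD B"] derivable_weak_R_D) auto

lemma conj_greatest:
  assumes "dderivable L (X \<turnstile>\<^sub>D FmD A)" "dderivable L (X \<turnstile>\<^sub>D FmD B)"
  shows "dderivable L (X \<turnstile>\<^sub>D FmD (A \<and>\<^sub>D B))"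
  using assms by (intro derivable_contr_L_D[OF derivable_conj_R_D])

lemma disj_least:
  assumes "dderivable L (FmD A \<turnstile>\<^sub>D X)" "dderivable L (FmD B \<turnstile>\<^sub>D X)"
  shows "dderivable L (FmD (A \<or>\<^sub>D B) \<turnstile>\<^sub>D X)"
  using assms by (intro derivable_contr_R_D[OF derivable_disj_L_D])

text \<open>Meets distribute over joins because the structural conjunction has a residual: moving \<open>A\<close> to the
  right leaves a sequent with the disjunction alone on the left.\<close>

lemma conj_disj_distrib:
  assumes "dderivable L (FmD A \<turnstile>\<^sub>D FmD A)" "dderivable L (FmD B \<turnstile>\<^sub>D FmD B)" "dderivable L (FmD E \<turnstile>\<^sub>D FmD E)"
  shows "dderivable L (FmD (A \<and>\<^sub>D (B \<or>\<^sub>D E)) \<turnstile>\<^sub>D FmD ((A \<and>\<^sub>D B) \<or>\<^sub>D (A \<and>\<^sub>D E)))" (is "dderivable L (_ \<turnstile>\<^sub>D ?F)")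
proof -
  have lang: "neg_free_dfm A" "neg_free_dfm B" "neg_free_dfm E" if "L = TQBA"
    using assms[THEN derivable_in_lang] that by (auto simp: in_lang_def)
  have "dderivable L (FmD A \<^bold>\<and> FmD B \<turnstile>\<^sub>D ?F)" "dderivable L (FmD A \<^bold>\<and> FmD E \<turnstile>\<^sub>D ?F)"
    using assms lang by (auto intro: disj_upper1 disj_upper2 derivable_conj_R_D)
  then have "dderivable L (FmD (B \<or>\<^sub>D E) \<turnstile>\<^sub>D FmD A \<^bold>\<rightarrow> ?F)"
    by (intro disj_least derivable_res_conj_D[THEN iffD1])
  then show ?thesis
    by (intro derivable_conj_L_D derivable_res_conj_D[THEN iffD2])
qed

lemma neg_antimono:
  assumes "dderivable L (FmD A \<turnstile>\<^sub>D FmD B)"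
  shows "dderivable L (FmD (\<not>\<^sub>D B) \<turnstile>\<^sub>D FmD (\<not>\<^sub>D A))"
  using derivable_neg_cont[THEN iffD1, OF assms] by (intro derivable_neg_L derivable_neg_R)

lemma neg_left:
  assumes "dderivable L (FmD A \<turnstile>\<^sub>D X)"
  shows "dderivable L (\<^bold>\<not> X \<turnstile>\<^sub>D FmD (\<not>\<^sub>D A))"
  using derivable_neg_cont[THEN iffD1, OF assms] by (rule derivable_neg_R)

lemma neg_right:
  assumes "dderivable L (X \<turnstile>\<^sub>D FmD A)"
  shows "dderivable L (FmD (\<not>\<^sub>D A) \<turnstile>\<^sub>D \<^bold>\<not> X)"
  using derivable_neg_cont[THEN iffD1, OF assms] by (rule derivable_neg_L)

lemma neg_neg_intro:
  assumes "dderivable L (FmD A \<turnstile>\<^sub>D FmD A)"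
  shows "dderivable L (FmD A \<turnstile>\<^sub>D FmD (\<not>\<^sub>D \<not>\<^sub>D A))"
  using neg_right[OF assms] by (rule derivable_neg_R[OF derivable_neg_adj_R[THEN iffD1]])

lemma neg_neg_elim:
  assumes "dderivable L (FmD A \<turnstile>\<^sub>D FmD A)"
  shows "dderivable L (FmD (\<not>\<^sub>D \<not>\<^sub>D A) \<turnstile>\<^sub>D FmD A)"
  using neg_left[OF assms] by (rule derivable_neg_L[OF derivable_neg_adj_L[THEN iffD1]])

section \<open>Interior and closure as adjoint pairs\<close>

text \<open>The formula connectives \<open>\<circ>\<^sub>I\<close> and \<open>\<box>\<^sub>I\<close> have separate introduction rules, and on the right \<open>\<box>\<^sub>I\<close> is
  introduced in kernel sequents only. The adjoint \<open>\<^bold>\<diamond>\<^sub>I\<close> of \<open>\<^bold>\<circ>\<^sub>I\<close> displays the kernel structure and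
  so allows \<open>interior_right\<close> to introduce both under any \<open>X\<close>. Dually \<open>closure_left\<close> uses the adjoint
  \<open>\<^bold>\<box>\<^sub>C\<close> of \<open>\<^bold>\<circ>\<^sub>C\<close>.\<close>

lemma interior_left:
  assumes "dderivable L (FmD A \<turnstile>\<^sub>D X)"
  shows "dderivable L (FmD (\<circ>\<^sub>I \<box>\<^sub>I A) \<turnstile>\<^sub>D \<^bold>\<circ>\<^sub>I \<^bold>\<box>\<^sub>I X)"
  using derivable_boxI_L[OF assms] by (intro derivable_circI_L derivable_circI_mono[THEN iffD2])

lemma interior_right:
  assumes "dderivable L (X \<turnstile>\<^sub>D \<^bold>\<circ>\<^sub>I \<^bold>\<box>\<^sub>I FmD A)"
  shows "dderivable L (X \<turnstile>\<^sub>D FmD (\<circ>\<^sub>I \<box>\<^sub>I A))"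
  using assms by (intro derivable_circI_R
      derivable_diaI_circI[THEN iffD2, OF derivable_boxI_R, OF derivable_diaI_circI[THEN iffD1]])

lemma closure_left:
  assumes "dderivable L (\<^bold>\<circ>\<^sub>C \<^bold>\<diamond>\<^sub>C FmD A \<turnstile>\<^sub>D X)"
  shows "dderivable L (FmD (\<circ>\<^sub>C \<diamond>\<^sub>C A) \<turnstile>\<^sub>D X)"
  using assms by (intro derivable_circC_L
      derivable_circC_boxC[THEN iffD2, OF derivable_diaC_L, OF derivable_circC_boxC[THEN iffD1]])

lemma closure_right:
  assumes "dderivable L (X \<turnstile>\<^sub>D FmD A)"
  shows "dderivable L (\<^bold>\<circ>\<^sub>C \<^bold>\<diamond>\<^sub>C X \<turnstile>\<^sub>D FmD (\<circ>\<^sub>C \<diamond>\<^sub>C A))"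
  using derivable_diaC_R[OF assms] by (intro derivable_circC_R) (simp add: derivable_circC_mono)

lemma interior_below:
  assumes "dderivable L (FmD A \<turnstile>\<^sub>D X)"
  shows "dderivable L (FmD (\<circ>\<^sub>I \<box>\<^sub>I A) \<turnstile>\<^sub>D X)"
  using derivable_boxI_L[OF assms] by (intro derivable_circI_L) (simp add: derivable_circI_boxI)

text \<open>The premise says that \<open>\<Gamma>\<close> lies below \<open>\<^bold>\<box>\<^sub>I A\<close> in the kernel, by adjointness; applying \<open>\<^bold>\<circ>\<^sub>I\<close> to both
  sides leaves \<open>\<^bold>\<circ>\<^sub>I \<Gamma>\<close> on the left.\<close>

lemma interior_greatest:
  assumes "dderivable L (\<^bold>\<circ>\<^sub>I \<Gamma> \<turnstile>\<^sub>D FmD A)"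
  shows "dderivable L (\<^bold>\<circ>\<^sub>I \<Gamma> \<turnstile>\<^sub>D FmD (\<circ>\<^sub>I \<box>\<^sub>I A))"
  using assms by (intro interior_right derivable_circI_mono[THEN iffD2] derivable_circI_boxI[THEN iffD1])

lemma embed_box_left:
  assumes "dderivable L (FmD A \<turnstile>\<^sub>D FmD A)"
  shows "dderivable L (\<^bold>\<circ>\<^sub>I FmI (\<box>\<^sub>I A) \<turnstile>\<^sub>D FmD (\<circ>\<^sub>I \<box>\<^sub>I A))"
  using derivable_boxI_L[OF assms] by (intro interior_right derivable_circI_mono[THEN iffD2])

lemma embed_box_right:
  assumes "dderivable L (FmD A \<turnstile>\<^sub>D FmD A)"
  shows "dderivable L (FmD (\<circ>\<^sub>I \<box>\<^sub>I A) \<turnstile>\<^sub>D \<^bold>\<circ>\<^sub>I FmI (\<box>\<^sub>I A))"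
  using derivable_boxI_R[OF derivable_boxI_L[OF assms]]
  by (intro derivable_circI_L derivable_circI_mono[THEN iffD2])

lemma closure_above:
  assumes "dderivable L (X \<turnstile>\<^sub>D FmD A)"
  shows "dderivable L (X \<turnstile>\<^sub>D FmD (\<circ>\<^sub>C \<diamond>\<^sub>C A))"
  using derivable_diaC_R[OF assms] by (intro derivable_circC_R) (simp add: derivable_diaC_circC)

lemma neg_free_transl [simp]: "neg_free_dfm (A\<^sup>\<tau>)"
  by (induction A) auto

text \<open>The calculus postulates identity for variables only.\<close>

lemma transl_refl: "dderivable L (FmD (A\<^sup>\<tau>) \<turnstile>\<^sub>D FmD (A\<^sup>\<tau>))"
proof (induction A)
  case (I A)
  then show ?case by (simp add: interior_left interior_right)
next
  case (C A)
  then show ?case by (simp add: closure_left closure_right)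
qed (simp_all add: derivable_ident derivable_one_L_D derivable_one_R_D derivable_zero_L_D
    derivable_zero_R_D neg_antimono conj_greatest conj_lower1 conj_lower2
    disj_least disj_upper1 disj_upper2)

section \<open>Modal axioms of the topological quasi-Boolean logic\<close>

lemma interior_mono:
  assumes "dderivable L (FmD A \<turnstile>\<^sub>D FmD B)"
  shows "dderivable L (FmD (\<circ>\<^sub>I \<box>\<^sub>I A) \<turnstile>\<^sub>D FmD (\<circ>\<^sub>I \<box>\<^sub>I B))"
  using assms by (intro interior_right interior_left)

lemma interior_idem:
  assumes "dderivable L (FmD A \<turnstile>\<^sub>D FmD A)"
  shows "dderivable L (FmD (\<circ>\<^sub>I \<box>\<^sub>I A) \<turnstile>\<^sub>D FmD (\<circ>\<^sub>I \<box>\<^sub>I \<circ>\<^sub>I \<box>\<^sub>I A))"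
  using assms by (rule derivable_circI_L[OF interior_greatest[OF embed_box_left]])

text \<open>The embedding of the kernel preserves the top by a rule of the calculus, so \<open>\<top>\<close> is an open element.\<close>

lemma interior_top: "dderivable L (FmD \<top>\<^sub>D \<turnstile>\<^sub>D FmD (\<circ>\<^sub>I \<box>\<^sub>I \<top>\<^sub>D))"
proof -
  have "dderivable L (\<^bold>\<circ>\<^sub>I \<^bold>\<one>\<^sub>I \<turnstile>\<^sub>D FmD \<top>\<^sub>D)"
    using derivable_one_R_D by (simp add: derivable_circI_one)
  then show ?thesis
    by (intro derivable_one_L_D) (simp add: derivable_circI_one interior_greatest)
qed

text \<open>By the left adjoint \<open>\<^bold>\<diamond>\<^sub>I\<close>, the two conjuncts become kernel elements above one and the same
  structure, and their meet can be formed in the kernel.\<close>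

lemma embed_meet_greatest:
  assumes "dderivable L (X \<turnstile>\<^sub>D \<^bold>\<circ>\<^sub>I FmI \<alpha>)" "dderivable L (X \<turnstile>\<^sub>D \<^bold>\<circ>\<^sub>I FmI \<beta>)"
  shows "dderivable L (X \<turnstile>\<^sub>D FmD (\<circ>\<^sub>I (\<alpha> \<inter>\<^sub>I \<beta>)))"
  using assms
  by (intro derivable_circI_R
      derivable_diaI_circI[THEN iffD2, OF derivable_contr_L_I[OF derivable_conj_R_I]])
    (simp_all add: derivable_diaI_circI)

lemma interior_conj:
  assumes "dderivable L (FmD A \<turnstile>\<^sub>D FmD A)" "dderivable L (FmD B \<turnstile>\<^sub>D FmD B)"
  shows "dderivable L (FmD (\<circ>\<^sub>I \<box>\<^sub>I A \<and>\<^sub>D \<circ>\<^sub>I \<box>\<^sub>I B) \<turnstile>\<^sub>D FmD (\<circ>\<^sub>I \<box>\<^sub>I (A \<and>\<^sub>D B)))"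
proof -
  let ?\<alpha> = "\<box>\<^sub>I A" and ?\<beta> = "\<box>\<^sub>I B"
  let ?X = "FmD (\<circ>\<^sub>I ?\<alpha> \<and>\<^sub>D \<circ>\<^sub>I ?\<beta>)"
  have lang: "neg_free_dfm A" "neg_free_dfm B" if "L = TQBA"
    using assms[THEN derivable_in_lang] that by (auto simp: in_lang_def)
  have "dderivable L (?X \<turnstile>\<^sub>D \<^bold>\<circ>\<^sub>I FmI ?\<alpha>)" "dderivable L (?X \<turnstile>\<^sub>D \<^bold>\<circ>\<^sub>I FmI ?\<beta>)"
    using assms lang by (auto intro: conj_lower1 conj_lower2 embed_box_right)
  then have meet: "dderivable L (?X \<turnstile>\<^sub>D FmD (\<circ>\<^sub>I (?\<alpha> \<inter>\<^sub>I ?\<beta>)))"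
    by (rule embed_meet_greatest)
  have "dderivable L (FmI (?\<alpha> \<inter>\<^sub>I ?\<beta>) \<turnstile>\<^sub>I \<^bold>\<box>\<^sub>I FmD A)"
    using assms lang by (intro derivable_conj_L_I derivable_weak_L_I derivable_boxI_L) auto
  moreover have "dderivable L (FmI (?\<alpha> \<inter>\<^sub>I ?\<beta>) \<turnstile>\<^sub>I \<^bold>\<box>\<^sub>I FmD B)"
    using assms lang
    by (intro derivable_conj_L_I derivable_comm_L_I[of L "FmI ?\<beta>"] derivable_weak_L_I derivable_boxI_L) auto
  ultimately have "dderivable L (\<^bold>\<circ>\<^sub>I FmI (?\<alpha> \<inter>\<^sub>I ?\<beta>) \<turnstile>\<^sub>D FmD (\<circ>\<^sub>I \<box>\<^sub>I (A \<and>\<^sub>D B)))"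
    by (intro interior_greatest conj_greatest derivable_circI_boxI[THEN iffD2])
  with meet show ?thesis by (blast intro: derivable_cut_D derivable_circI_L)
qed

text \<open>The rules relating negation and modalities act on structures. Each of the four inclusions between a
  modality and the negation of its dual therefore starts with one formula modality against its
  structural counterpart, converts the structural one into its dual, and displays the result by the
  adjunction of negation so that the dual can be made a formula.\<close>

lemma closure_imp_neg_interior_neg:
  assumes "dderivable L (FmD A \<turnstile>\<^sub>D FmD A)"
  shows "dderivable L (FmD (\<circ>\<^sub>C \<diamond>\<^sub>C A) \<turnstile>\<^sub>D FmD (\<not>\<^sub>D \<circ>\<^sub>I \<box>\<^sub>I \<not>\<^sub>D A))"
proof -
  have "dderivable L (FmD (\<circ>\<^sub>I \<box>\<^sub>I \<not>\<^sub>D A) \<turnstile>\<^sub>D \<^bold>\<circ>\<^sub>I \<^bold>\<box>\<^sub>I \<^bold>\<not> FmD A)"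
    using assms by (intro interior_left neg_right)
  then have "dderivable L (\<^bold>\<circ>\<^sub>C \<^bold>\<diamond>\<^sub>C FmD A \<turnstile>\<^sub>D \<^bold>\<not> FmD (\<circ>\<^sub>I \<box>\<^sub>I \<not>\<^sub>D A))"
    by (rule derivable_neg_adj_R[THEN iffD1, OF derivable_boxI_neg[THEN iffD1]])
  then show ?thesis by (intro closure_left derivable_neg_R)
qed

lemma neg_interior_neg_imp_closure:
  assumes "dderivable L (FmD A \<turnstile>\<^sub>D FmD A)"
  shows "dderivable L (FmD (\<not>\<^sub>D \<circ>\<^sub>I \<box>\<^sub>I \<not>\<^sub>D A) \<turnstile>\<^sub>D FmD (\<circ>\<^sub>C \<diamond>\<^sub>C A))"
proof -
  have "dderivable L (\<^bold>\<not> FmD (\<not>\<^sub>D A) \<turnstile>\<^sub>D FmD A)"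
    using neg_left[OF assms] by (rule derivable_neg_adj_L[THEN iffD1])
  then have "dderivable L (\<^bold>\<not> \<^bold>\<circ>\<^sub>I \<^bold>\<box>\<^sub>I FmD (\<not>\<^sub>D A) \<turnstile>\<^sub>D FmD (\<circ>\<^sub>C \<diamond>\<^sub>C A))"
    by (intro derivable_diaC_neg[THEN iffD1] closure_right)
  then have "dderivable L (\<^bold>\<not> FmD (\<circ>\<^sub>C \<diamond>\<^sub>C A) \<turnstile>\<^sub>D FmD (\<circ>\<^sub>I \<box>\<^sub>I \<not>\<^sub>D A))"
    by (rule interior_right[OF derivable_neg_adj_L[THEN iffD1]])
  then show ?thesis by (rule derivable_neg_L[OF derivable_neg_adj_L[THEN iffD1]])
qed

lemma neg_closure_neg_imp_interior:
  assumes "dderivable L (FmD A \<turnstile>\<^sub>D FmD A)"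
  shows "dderivable L (FmD (\<not>\<^sub>D \<circ>\<^sub>C \<diamond>\<^sub>C \<not>\<^sub>D A) \<turnstile>\<^sub>D FmD (\<circ>\<^sub>I \<box>\<^sub>I A))"
proof -
  have "dderivable L (\<^bold>\<circ>\<^sub>C \<^bold>\<diamond>\<^sub>C \<^bold>\<not> FmD A \<turnstile>\<^sub>D FmD (\<circ>\<^sub>C \<diamond>\<^sub>C \<not>\<^sub>D A))"
    using assms by (intro closure_right neg_left)
  then have "dderivable L (\<^bold>\<not> FmD (\<circ>\<^sub>C \<diamond>\<^sub>C \<not>\<^sub>D A) \<turnstile>\<^sub>D \<^bold>\<circ>\<^sub>I \<^bold>\<box>\<^sub>I FmD A)"
    by (rule derivable_neg_adj_L[THEN iffD1, OF derivable_diaC_neg[THEN iffD1]])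
  then show ?thesis by (intro derivable_neg_L interior_right)
qed

lemma interior_imp_neg_closure_neg:
  assumes "dderivable L (FmD A \<turnstile>\<^sub>D FmD A)"
  shows "dderivable L (FmD (\<circ>\<^sub>I \<box>\<^sub>I A) \<turnstile>\<^sub>D FmD (\<not>\<^sub>D \<circ>\<^sub>C \<diamond>\<^sub>C \<not>\<^sub>D A))"
proof -
  have "dderivable L (FmD A \<turnstile>\<^sub>D \<^bold>\<not> FmD (\<not>\<^sub>D A))"
    using neg_right[OF assms] by (rule derivable_neg_adj_R[THEN iffD1])
  then have "dderivable L (FmD (\<circ>\<^sub>I \<box>\<^sub>I A) \<turnstile>\<^sub>D \<^bold>\<not> \<^bold>\<circ>\<^sub>C \<^bold>\<diamond>\<^sub>C FmD (\<not>\<^sub>D A))"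
    by (intro interior_left derivable_boxI_neg[THEN iffD1])
  then have "dderivable L (FmD (\<circ>\<^sub>C \<diamond>\<^sub>C \<not>\<^sub>D A) \<turnstile>\<^sub>D \<^bold>\<not> FmD (\<circ>\<^sub>I \<box>\<^sub>I A))"
    by (rule closure_left[OF derivable_neg_adj_R[THEN iffD1]])
  then show ?thesis by (rule derivable_neg_R[OF derivable_neg_adj_R[THEN iffD1]])
qed

section \<open>Axioms and rules of the extensions\<close>

text \<open>The interior of \<open>A\<close> lies below \<open>\<^bold>\<circ>\<^sub>C \<^bold>\<box>\<^sub>C A\<close>, which is the same as \<open>\<^bold>\<circ>\<^sub>I \<^bold>\<box>\<^sub>I A\<close>. Being in the image of
  \<open>\<^bold>\<circ>\<^sub>C\<close>, this bounds the closure of every element below it, by the adjunction of \<open>\<^bold>\<diamond>\<^sub>C\<close> and \<open>\<^bold>\<circ>\<^sub>C\<close>.\<close>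

lemma closure_of_interior:
  assumes "L \<noteq> TQBA" "dderivable L (FmD A \<turnstile>\<^sub>D FmD A)"
  shows "dderivable L (FmD (\<circ>\<^sub>C \<diamond>\<^sub>C \<circ>\<^sub>I \<box>\<^sub>I A) \<turnstile>\<^sub>D FmD (\<circ>\<^sub>I \<box>\<^sub>I A))"
proof -
  have "dderivable L (FmD (\<circ>\<^sub>I \<box>\<^sub>I A) \<turnstile>\<^sub>D \<^bold>\<circ>\<^sub>C \<^bold>\<box>\<^sub>C FmD A)"
    using interior_left[OF assms(2)] by (rule derivable_boxI_boxC[OF assms(1), THEN iffD1])
  then have "dderivable L (\<^bold>\<circ>\<^sub>C \<^bold>\<diamond>\<^sub>C FmD (\<circ>\<^sub>I \<box>\<^sub>I A) \<turnstile>\<^sub>D \<^bold>\<circ>\<^sub>C \<^bold>\<box>\<^sub>C FmD A)"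
    by (intro derivable_circC_mono[THEN iffD2] derivable_diaC_circC[THEN iffD1])
  then show ?thesis
    by (intro interior_right derivable_boxI_boxC[OF assms(1), THEN iffD2] closure_left)
qed

text \<open>The right adjoint \<open>\<^bold>\<box>\<^sub>I\<close> turns both bounds into bounds in the kernel, where the join can be formed. This
  lets a disjunction that holds in the kernel be used in the algebra.\<close>

lemma embed_join_least:
  assumes "dderivable L (\<Gamma> \<turnstile>\<^sub>I FmI \<alpha> \<^bold>\<union> FmI \<beta>)"
    and "dderivable L (\<^bold>\<circ>\<^sub>I FmI \<alpha> \<turnstile>\<^sub>D X)" "dderivable L (\<^bold>\<circ>\<^sub>I FmI \<beta> \<turnstile>\<^sub>D X)"
  shows "dderivable L (\<^bold>\<circ>\<^sub>I \<Gamma> \<turnstile>\<^sub>D X)"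
proof -
  have "dderivable L (FmI (\<alpha> \<union>\<^sub>I \<beta>) \<turnstile>\<^sub>I \<^bold>\<box>\<^sub>I X)"
    using assms(2,3) by (intro derivable_contr_R_I[OF derivable_disj_L_I] derivable_circI_boxI[THEN iffD1])
  with assms(1) show ?thesis
    by (rule derivable_circI_boxI[THEN iffD2, OF derivable_cut_I[OF derivable_disj_R_I]])
qed

text \<open>The kernel is Boolean by the added rule, and the embedding sends the kernel negation of \<open>\<box>\<^sub>I A\<close> below
  the negation of \<open>\<circ>\<^sub>I \<box>\<^sub>I A\<close>.\<close>

lemma interior_excluded_middle:
  assumes "L \<in> {IA1, PRA}" "dderivable L (FmD A \<turnstile>\<^sub>D FmD A)"
  shows "dderivable L (FmD \<top>\<^sub>D \<turnstile>\<^sub>D FmD (\<circ>\<^sub>I \<box>\<^sub>I A \<or>\<^sub>D \<not>\<^sub>D \<circ>\<^sub>I \<box>\<^sub>I A))" (is "dderivable L (_ \<turnstile>\<^sub>D ?F)")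
proof -
  let ?\<alpha> = "\<box>\<^sub>I A"
  have L: "L \<noteq> TQBA" using assms(1) by auto
  have refl: "dderivable L (FmI ?\<alpha> \<turnstile>\<^sub>I FmI ?\<alpha>)"
    using assms(2) by (intro derivable_boxI_R derivable_boxI_L)
  have "dderivable L (\<^bold>\<one>\<^sub>I \<turnstile>\<^sub>I \<^bold>\<sim> FmI ?\<alpha> \<^bold>\<union> FmI ?\<alpha>)"
    using refl L by (intro derivable_cgri_I[OF assms(1)] derivable_weak_L_I) auto
  then have "dderivable L (FmI ?\<alpha> \<^bold>\<succ>\<^sub>I \<^bold>\<one>\<^sub>I \<turnstile>\<^sub>I FmI (\<sim>\<^sub>I ?\<alpha>))"
    by (rule derivable_negI_R[OF L derivable_res_disj_I[THEN iffD1, OF derivable_comm_R_I]])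
  then have kernel: "dderivable L (\<^bold>\<one>\<^sub>I \<turnstile>\<^sub>I FmI ?\<alpha> \<^bold>\<union> FmI (\<sim>\<^sub>I ?\<alpha>))"
    by (rule derivable_res_disj_I[THEN iffD2])
  have pos: "dderivable L (\<^bold>\<circ>\<^sub>I FmI ?\<alpha> \<turnstile>\<^sub>D ?F)"
    using assms(2) L by (intro disj_upper1 embed_box_left) auto
  have "dderivable L (FmI (\<sim>\<^sub>I ?\<alpha>) \<turnstile>\<^sub>I \<^bold>\<sim> FmI ?\<alpha>)"
    using refl by (intro derivable_negI_L[OF L] derivable_negI_cont[OF L, THEN iffD1])
  then have "dderivable L (\<^bold>\<circ>\<^sub>I FmI (\<sim>\<^sub>I ?\<alpha>) \<turnstile>\<^sub>D \<^bold>\<not> \<^bold>\<circ>\<^sub>I FmI ?\<alpha>)"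
    by (intro derivable_circI_negI[OF L] derivable_circI_mono[THEN iffD2])
  then have "dderivable L (FmD (\<circ>\<^sub>I ?\<alpha>) \<turnstile>\<^sub>D \<^bold>\<not> \<^bold>\<circ>\<^sub>I FmI (\<sim>\<^sub>I ?\<alpha>))"
    by (rule derivable_circI_L[OF derivable_neg_adj_R[THEN iffD1]])
  then have "dderivable L (\<^bold>\<circ>\<^sub>I FmI (\<sim>\<^sub>I ?\<alpha>) \<turnstile>\<^sub>D FmD (\<not>\<^sub>D \<circ>\<^sub>I ?\<alpha>))"
    by (rule derivable_neg_R[OF derivable_neg_adj_R[THEN iffD1]])
  then have "dderivable L (\<^bold>\<circ>\<^sub>I FmI (\<sim>\<^sub>I ?\<alpha>) \<turnstile>\<^sub>D ?F)"
    using L by (intro disj_upper2) auto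
  with kernel pos have "dderivable L (\<^bold>\<circ>\<^sub>I \<^bold>\<one>\<^sub>I \<turnstile>\<^sub>D ?F)" by (rule embed_join_least)
  then show ?thesis by (intro derivable_one_L_D derivable_circI_one[THEN iffD2])
qed

text \<open>The added rule gives distribution for the structural boxes in the kernel. Each of them is displayed
  in turn to be made a formula, because \<open>embed_join_least\<close> cuts on a kernel formula.\<close>

lemma interior_disj:
  assumes "L \<in> {IA2, PRA}" "dderivable L (FmD A \<turnstile>\<^sub>D FmD A)" "dderivable L (FmD B \<turnstile>\<^sub>D FmD B)"
  shows "dderivable L (FmD (\<circ>\<^sub>I \<box>\<^sub>I (A \<or>\<^sub>D B)) \<turnstile>\<^sub>D FmD (\<circ>\<^sub>I \<box>\<^sub>I A \<or>\<^sub>D \<circ>\<^sub>I \<box>\<^sub>I B))" (is "dderivable L (_ \<turnstile>\<^sub>D ?F)")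
proof -
  let ?\<gamma> = "FmI (\<box>\<^sub>I (A \<or>\<^sub>D B))"
  have L: "L \<noteq> TQBA" using assms(1) by auto
  have "dderivable L (?\<gamma> \<turnstile>\<^sub>I \<^bold>\<box>\<^sub>I FmD A \<^bold>\<union> \<^bold>\<box>\<^sub>I FmD B)"
    using assms by (intro derivable_ia2_I derivable_boxI_L derivable_disj_L_D)
  then have "dderivable L (\<^bold>\<box>\<^sub>I FmD A \<^bold>\<succ>\<^sub>I ?\<gamma> \<turnstile>\<^sub>I FmI (\<box>\<^sub>I B))"
    by (intro derivable_boxI_R derivable_res_disj_I[THEN iffD1])
  then have "dderivable L (?\<gamma> \<turnstile>\<^sub>I \<^bold>\<box>\<^sub>I FmD A \<^bold>\<union> FmI (\<box>\<^sub>I B))"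
    by (rule derivable_res_disj_I[THEN iffD2])
  then have "dderivable L (FmI (\<box>\<^sub>I B) \<^bold>\<succ>\<^sub>I ?\<gamma> \<turnstile>\<^sub>I FmI (\<box>\<^sub>I A))"
    by (rule derivable_boxI_R[OF derivable_res_disj_I[THEN iffD1, OF derivable_comm_R_I]])
  then have kernel: "dderivable L (?\<gamma> \<turnstile>\<^sub>I FmI (\<box>\<^sub>I B) \<^bold>\<union> FmI (\<box>\<^sub>I A))"
    by (rule derivable_res_disj_I[THEN iffD2])
  have "dderivable L (\<^bold>\<circ>\<^sub>I FmI (\<box>\<^sub>I A) \<turnstile>\<^sub>D ?F)" "dderivable L (\<^bold>\<circ>\<^sub>I FmI (\<box>\<^sub>I B) \<turnstile>\<^sub>D ?F)"
    using assms(2,3) L by (auto intro: disj_upper1 disj_upper2 embed_box_left)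
  with kernel show ?thesis by (intro derivable_circI_L) (rule embed_join_least)
qed

text \<open>The rule of the calculus gives \<open>A \<and> C B \<turnstile> I A \<or> B\<close>. The left side is no smaller than \<open>A\<close>, as
  \<open>A \<turnstile> C A \<turnstile> C B\<close>, and the right side no larger than \<open>B\<close>, as \<open>I A \<turnstile> I B \<turnstile> B\<close>.\<close>

lemma interior_closure_determine:
  assumes "L \<in> {IA3, PRA}" "dderivable L (FmD A \<turnstile>\<^sub>D FmD A)" "dderivable L (FmD B \<turnstile>\<^sub>D FmD B)"
    and "dderivable L (FmD (\<circ>\<^sub>I \<box>\<^sub>I A) \<turnstile>\<^sub>D FmD (\<circ>\<^sub>I \<box>\<^sub>I B))"
    and "dderivable L (FmD (\<circ>\<^sub>C \<diamond>\<^sub>C A) \<turnstile>\<^sub>D FmD (\<circ>\<^sub>C \<diamond>\<^sub>C B))"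
  shows "dderivable L (FmD A \<turnstile>\<^sub>D FmD B)"
proof -
  let ?R = "\<^bold>\<circ>\<^sub>I \<^bold>\<box>\<^sub>I FmD A \<^bold>\<or> FmD B"
  have "dderivable L (\<^bold>\<circ>\<^sub>C \<^bold>\<diamond>\<^sub>C FmD B \<turnstile>\<^sub>D FmD A \<^bold>\<rightarrow> ?R)"
    using derivable_ia3[OF assms(1-3)] by (rule derivable_res_conj_D[THEN iffD1])
  then have "dderivable L (FmD (\<circ>\<^sub>C \<diamond>\<^sub>C B) \<turnstile>\<^sub>D FmD A \<^bold>\<rightarrow> ?R)"
    by (rule closure_left)
  then have "dderivable L (FmD A \<turnstile>\<^sub>D FmD A \<^bold>\<rightarrow> ?R)"
    by (rule derivable_cut_D[OF derivable_cut_D[OF closure_above[OF assms(2)] assms(5)]])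
  then have "dderivable L (FmD A \<turnstile>\<^sub>D FmD B \<^bold>\<or> \<^bold>\<circ>\<^sub>I \<^bold>\<box>\<^sub>I FmD A)"
    by (rule derivable_comm_R_D[OF derivable_contr_L_D[OF derivable_res_conj_D[THEN iffD2]]])
  then have "dderivable L (FmD B \<^bold>\<succ> FmD A \<turnstile>\<^sub>D FmD (\<circ>\<^sub>I \<box>\<^sub>I A))"
    by (intro interior_right derivable_res_disj_D[THEN iffD1])
  then have "dderivable L (FmD B \<^bold>\<succ> FmD A \<turnstile>\<^sub>D FmD B)"
    by (rule derivable_cut_D[OF _ derivable_cut_D[OF assms(4) interior_below[OF assms(3)]]])
  then show ?thesis by (rule derivable_contr_R_D[OF derivable_res_disj_D[THEN iffD2]])
qed

section \<open>Simulation of the Hilbert-style derivations\<close>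

theorem proposition6:
  fixes L :: system and A B :: fm
  assumes "hderivable L A B"
  shows "dderivable L (FmD (A\<^sup>\<tau>) \<turnstile>\<^sub>D FmD (B\<^sup>\<tau>))"
  using assms
proof induction
  case (h_trans A B E)
  then show ?case by (blast intro: derivable_cut_D)
next
  case (h_ia3 A B)
  then show ?case by (intro interior_closure_determine[OF _ transl_refl transl_refl]) simp_all
qed (simp_all add: transl_refl in_lang_def bot_least top_greatest conj_lower1 conj_lower2 disj_upper1
    disj_upper2 conj_disj_distrib conj_greatest disj_least neg_antimono neg_neg_intro neg_neg_elim
    interior_below interior_idem interior_mono interior_conj interior_top
    closure_imp_neg_interior_neg neg_interior_neg_imp_closure
    neg_closure_neg_imp_interior interior_imp_neg_closure_neg
    closure_of_interior interior_excluded_middle interior_disj)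

end
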